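(* The Syzygy functor $\pi^\bullet:(\mathrm{pers}(\mathbb{R}^n),d_I)\to (K^-(\mathrm{pers}(\mathbb{R}^n)),d_I^K)$, sending a module to its minimal free resolution, is distance preserving: for all $M,N$ in $\mathrm{pers}(\mathbb{R}^n)$, $$d_I^K(\pi^\bullet(M),\pi^\bullet(N))=d_I(M,N).$$
   Context: Fix a field $\mathbf{k}$ and an integer $n>0$; $\mathbb{R}^n$ carries the product partial order, viewed as a poset category. A persistence module over $\mathbb{R}^n$ is a functor $(\mathbb{R}^n,\le)\to\mathrm{Mod}(\mathbf{k})$ (the category of $\mathbf{k}$-vector spaces); with natural transformations these form the abelian category $\mathrm{Pers}(\mathbb{R}^n)$. Free and finitely presented modules. For $a\in\mathbb{R}^n$, $F_a$ is the module with $F_a(s)=\mathbf{k}$ if $a\le s$ and $0$ otherwise, and $F_a(s\le t)=\mathrm{id}_{\mathbf{k}}$ if $a\le s$ and $0$ otherwise. A module is free if it is isomorphic to a finite direct sum of modules $F_a$; free modules are projective. A module is finitely presented if it is the cokernel of a morphism between two free modules. $\mathrm{pers}(\mathbb{R}^n)$ is the full subcategory of $\mathrm{Pers}(\mathbb{R}^n)$ of finitely presented modules. Minimal free resolutions. A free resolution $(F^\bullet,\partial^\bullet)$ of $M$ is a complex of free modules in degrees $\le0$ with $\mathrm{H}^j=0$ for $j\neq0$ and $\mathrm{H}^0\simeq M$. It is minimal if for every $j$ and every $s\in\mathbb{R}^n$, $\partial^j(F^j(s))\subset\sum_{t\le s,\,t\ne s}\mathrm{im}\,F^{j+1}(t\le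 s)$ (equivalently, after discretizing along a grid, the image of $\partial^j$ lies in $I\cdot F^{j+1}$, $I=\langle x_1,\dots,x_n\rangle$ being the maximal graded ideal of $\mathbf{k}[x_1,\dots,x_n]$). By Hilbert's syzygy theorem every finitely presented $M$ has a minimal free resolution $\pi^\bullet(M)$, unique up to isomorphism of complexes and vanishing in degrees $<-n$. Syzygy functor. $\pi^\bullet$ sends $M$ to its (chosen) minimal free resolution and a morphism to the homotopy class of any chain map lifting it. $K^-(\mathrm{pers}(\mathbb{R}^n))$ is the category of right-bounded cochain complexes of objects of $\mathrm{pers}(\mathbb{R}^n)$ with morphisms chain maps modulo chain homotopy. Distances. For $\varepsilon\in\mathbb{R}$, $M[\varepsilon](s)=M(s+(\varepsilon,\dots,\varepsilon))$, with the corresponding internal maps. For $\varepsilon\ge 0$, $s_\varepsilon^M:M\to M[\varepsilon]$ has components $M(t\le t+(\varepsilon,\dots,\varepsilon))$. $M,N$ are $\varepsilon$-interleaved if there are $f:M\to N[\varepsilon]$, $g:N\to M[\varepsilon]$ with $g[\varepsilon]\circ f=s_{2\varepsilon}^M$ and $f[\varepsilon]\circ g=s_{2\varepsilon}^N$; $d_I(M,N)\in[0,+\infty]$ is the infimum of such $\varepsilon\in\mathbb{R}_{\ge0}$. For complexes, $X[\varepsilon]$ is $[\varepsilon]$ applied degreewise (not the homological shift) and $[s_\varepsilon^X]$ is the homotopy class of the chain map $X\to X[\varepsilon]$ equal to $s_\varepsilon^{X^i}$ in degree $i$. $X,Y$ are $\varepsilon$-interleaved if there are morphisms $f:X\to Y[\varepsilon]$,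 $g:Y\to X[\varepsilon]$ in the homotopy category with $g[\varepsilon]\circ f=[s_{2\varepsilon}^X]$ and $f[\varepsilon]\circ g=[s_{2\varepsilon}^Y]$; $d_I^K(X,Y)\in[0,+\infty]$ is the infimum of such $\varepsilon\in\mathbb{R}_{\ge0}$. *)

theory Defs
  imports "HOL-Analysis.Analysis" "HOL-Library.Function_Algebras"
begin

section \<open>Persistence modules over $R^n$\<close>

text \<open>
  The index poset is \<^typ>\<open>real^'n\<close> with its library order, which is the componentwise one.

  A functor from it to \<open>'k\<close>-vector spaces is encoded by subspaces \<open>fibre M s\<close> of one ambient
  \<open>'k\<close>-vector space (the type \<open>'v\<close> with scalar multiplication \<open>scl M\<close>) together with transition
  maps \<open>tr M s t\<close>, of which only the values on \<open>fibre M s\<close> for \<open>s \<le> t\<close> are meaningful.  This loses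
  no generality: every functor \<open>V\<close> is isomorphic to one of this form, with the direct sum of
  all \<open>V s\<close> as ambient space.  Morphisms are likewise functions that are
  meaningful on the fibres only, and are compared on the fibres only.
\<close>

record ('k, 'n, 'v) pers =
  fibre :: "real^'n \<Rightarrow> 'v set"
  scl :: "'k \<Rightarrow> 'v \<Rightarrow> 'v"
  tr :: "real^'n \<Rightarrow> real^'n \<Rightarrow> 'v \<Rightarrow> 'v"

type_synonym ('n, 'v, 'w) pmor = "real^'n \<Rightarrow> 'v \<Rightarrow> 'w"

definition linear_between ::
  "('k \<Rightarrow> 'v \<Rightarrow> 'v) \<Rightarrow> ('k \<Rightarrow> 'w \<Rightarrow> 'w) \<Rightarrow> 'v::ab_group_add set \<Rightarrow> 'w::ab_group_add set
    \<Rightarrow> ('v \<Rightarrow> 'w) \<Rightarrow> bool" where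
  "linear_between c c' V W f \<longleftrightarrow>
     (\<forall>x\<in>V. f x \<in> W) \<and>
     (\<forall>x\<in>V. \<forall>y\<in>V. f (x + y) = f x + f y) \<and>
     (\<forall>a. \<forall>x\<in>V. f (c a x) = c' a (f x))"

definition persistence_module :: "('k::field, 'n::finite, 'v::ab_group_add) pers \<Rightarrow> bool" where
  "persistence_module M \<longleftrightarrow>
     vector_space (scl M) \<and>
     (\<forall>s. module.subspace (scl M) (fibre M s)) \<and>
     (\<forall>s t. s \<le> t \<longrightarrow> linear_between (scl M) (scl M) (fibre M s) (fibre M t) (tr M s t)) \<and>
     (\<forall>s. \<forall>x\<in>fibre M s. tr M s s x = x) \<and>
     (\<forall>r s t. r \<le> s \<longrightarrow> s \<le> t \<longrightarrow> (\<forall>x\<in>fibre M r. tr M s t (tr M r s x) = tr M r t x))"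

definition pers_hom ::
  "('k::field, 'n::finite, 'v::ab_group_add) pers \<Rightarrow> ('k, 'n, 'w::ab_group_add) pers
    \<Rightarrow> ('n, 'v, 'w) pmor set" where
  "pers_hom M N = {f.
     (\<forall>s. linear_between (scl M) (scl N) (fibre M s) (fibre N s) (f s)) \<and>
     (\<forall>s t. s \<le> t \<longrightarrow> (\<forall>x\<in>fibre M s. f t (tr M s t x) = tr N s t (f s x)))}"

definition pmor_eq ::
  "('k, 'n::finite, 'v) pers \<Rightarrow> ('n, 'v, 'w) pmor \<Rightarrow> ('n, 'v, 'w) pmor \<Rightarrow> bool" where
  "pmor_eq M f g \<longleftrightarrow> (\<forall>s. \<forall>x\<in>fibre M s. f s x = g s x)"

definition pmor_id :: "('n::finite, 'v, 'v) pmor" where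
  "pmor_id = (\<lambda>s x. x)"

definition pmor_comp ::
  "('n::finite, 'v, 'w) pmor \<Rightarrow> ('n, 'u, 'v) pmor \<Rightarrow> ('n, 'u, 'w) pmor" where
  "pmor_comp g f = (\<lambda>s x. g s (f s x))"

definition pers_iso ::
  "('k::field, 'n::finite, 'v::ab_group_add) pers \<Rightarrow> ('k, 'n, 'w::ab_group_add) pers \<Rightarrow> bool" where
  "pers_iso M N \<longleftrightarrow> (\<exists>f\<in>pers_hom M N. \<exists>g\<in>pers_hom N M.
     pmor_eq M (pmor_comp g f) pmor_id \<and> pmor_eq N (pmor_comp f g) pmor_id)"

section \<open>Free and finitely presented modules\<close>

definition elementary_free :: "real^'n \<Rightarrow> ('k::field, 'n::finite, 'k) pers" where
  "elementary_free a =
     \<lparr> fibre = (\<lambda>s. if a \<le> s then UNIV else {0}),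
       scl = (*),
       tr = (\<lambda>s t x. if a \<le> s then x else 0) \<rparr>"

text \<open>The direct sum of the modules $F_a$ for \<open>a\<close> in a list, with multiplicity.  Its elements are
  coordinate sequences vanishing beyond the length of the list.\<close>

definition free_sum :: "(real^'n) list \<Rightarrow> ('k::field, 'n::finite, nat \<Rightarrow> 'k) pers" where
  "free_sum as =
     \<lparr> fibre = (\<lambda>s. {v. (\<forall>i<length as. v i \<in> fibre (elementary_free (as ! i)) s) \<and>
                        (\<forall>i\<ge>length as. v i = 0)}),
       scl = (\<lambda>c v i. c * v i),
       tr = (\<lambda>s t v i. if i < length as then tr (elementary_free (as ! i)) s t (v i) else 0) \<rparr>"

definition free_module :: "('k::field, 'n::finite, 'v::ab_group_add) pers \<Rightarrow> bool" where
  "free_module M \<longleftrightarrow> persistence_module M \<and> (\<exists>as. pers_iso M (free_sum as))"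

text \<open>\<open>q\<close> exhibits \<open>M\<close> as the cokernel of \<open>p : F1 \<rightarrow> F0\<close>; cokernels of persistence modules are
  computed pointwise, so this says that \<open>q s\<close> induces an isomorphism from the quotient of
  \<open>fibre F0 s\<close> by the image of \<open>p s\<close> onto \<open>fibre M s\<close>.\<close>

definition is_cokernel ::
  "('k::field, 'n::finite, 'u::ab_group_add) pers \<Rightarrow> ('k, 'n, 'w::ab_group_add) pers
    \<Rightarrow> ('n, 'u, 'w) pmor \<Rightarrow> ('k, 'n, 'v::ab_group_add) pers \<Rightarrow> ('n, 'w, 'v) pmor \<Rightarrow> bool" where
  "is_cokernel F1 F0 p M q \<longleftrightarrow>
     p \<in> pers_hom F1 F0 \<and> q \<in> pers_hom F0 M \<and>
     (\<forall>s. q s ` fibre F0 s = fibre M s \<and> {x\<in>fibre F0 s. q s x = 0} = p s ` fibre F1 s)"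

text \<open>The presenting modules may be taken with the ambient space of \<^const>\<open>free_sum\<close>, because every
  free module is isomorphic to one of these.\<close>

definition finitely_presented :: "('k::field, 'n::finite, 'v::ab_group_add) pers \<Rightarrow> bool" where
  "finitely_presented M \<longleftrightarrow> persistence_module M \<and>
     (\<exists>(F1 :: ('k, 'n, nat \<Rightarrow> 'k) pers) (F0 :: ('k, 'n, nat \<Rightarrow> 'k) pers) p q.
        free_module F1 \<and> free_module F0 \<and> is_cokernel F1 F0 p M q)"

section \<open>Cochain complexes and minimal free resolutions\<close>

record ('k, 'n, 'v) cochain =
  obj :: "int \<Rightarrow> ('k, 'n, 'v) pers"
  diff :: "int \<Rightarrow> real^'n \<Rightarrow> 'v \<Rightarrow> 'v"

type_synonym ('n, 'v, 'w) cmor = "int \<Rightarrow> ('n, 'v, 'w) pmor"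

definition cochain_complex :: "('k::field, 'n::finite, 'v::ab_group_add) cochain \<Rightarrow> bool" where
  "cochain_complex X \<longleftrightarrow>
     (\<forall>i. persistence_module (obj X i)) \<and>
     (\<forall>i. diff X i \<in> pers_hom (obj X i) (obj X (i + 1))) \<and>
     (\<forall>i s. \<forall>x\<in>fibre (obj X i) s. diff X (i + 1) s (diff X i s x) = 0)"

definition cocycles ::
  "('k, 'n::finite, 'v::zero) cochain \<Rightarrow> int \<Rightarrow> real^'n \<Rightarrow> 'v set" where
  "cocycles X i s = {x\<in>fibre (obj X i) s. diff X i s x = 0}"

definition coboundaries ::
  "('k, 'n::finite, 'v) cochain \<Rightarrow> int \<Rightarrow> real^'n \<Rightarrow> 'v set" where
  "coboundaries X i s = diff X (i - 1) s ` fibre (obj X (i - 1)) s"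

text \<open>$H^i(X)$ is isomorphic to \<open>M\<close>: there is a surjective morphism from the module of
  \<open>i\<close>-cocycles onto \<open>M\<close> whose kernel is the module of \<open>i\<close>-coboundaries.\<close>

definition cohomology_iso ::
  "('k::field, 'n::finite, 'v::ab_group_add) cochain \<Rightarrow> int
    \<Rightarrow> ('k, 'n, 'w::ab_group_add) pers \<Rightarrow> bool" where
  "cohomology_iso X i M \<longleftrightarrow>
     (\<exists>e \<in> pers_hom (obj X i \<lparr> fibre := cocycles X i \<rparr>) M.
        \<forall>s. e s ` cocycles X i s = fibre M s \<and>
            {x\<in>cocycles X i s. e s x = 0} = coboundaries X i s)"

definition free_resolution ::
  "('k::field, 'n::finite, 'v::ab_group_add) cochain \<Rightarrow> ('k, 'n, 'w::ab_group_add) pers \<Rightarrow> bool" where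
  "free_resolution X M \<longleftrightarrow>
     cochain_complex X \<and>
     (\<forall>i. free_module (obj X i)) \<and>
     (\<forall>i>0. \<forall>s. fibre (obj X i) s = {0}) \<and>
     (\<forall>i. i \<noteq> 0 \<longrightarrow> (\<forall>s. cocycles X i s = coboundaries X i s)) \<and>
     cohomology_iso X 0 M"

definition minimal_free_resolution ::
  "('k::field, 'n::finite, 'v::ab_group_add) cochain \<Rightarrow> ('k, 'n, 'w::ab_group_add) pers \<Rightarrow> bool" where
  "minimal_free_resolution X M \<longleftrightarrow>
     free_resolution X M \<and>
     (\<forall>j s. diff X j s ` fibre (obj X j) s \<subseteq>
        module.span (scl (obj X (j + 1)))
          (\<Union>t\<in>{t. t \<le> s \<and> t \<noteq> s}. tr (obj X (j + 1)) t s ` fibre (obj X (j + 1)) t))"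

section \<open>The homotopy category\<close>

definition chain_hom ::
  "('k::field, 'n::finite, 'v::ab_group_add) cochain \<Rightarrow> ('k, 'n, 'w::ab_group_add) cochain
    \<Rightarrow> ('n, 'v, 'w) cmor set" where
  "chain_hom X Y = {\<phi>.
     (\<forall>i. \<phi> i \<in> pers_hom (obj X i) (obj Y i)) \<and>
     (\<forall>i s. \<forall>x\<in>fibre (obj X i) s. \<phi> (i + 1) s (diff X i s x) = diff Y i s (\<phi> i s x))}"

definition chain_comp ::
  "('n::finite, 'v, 'w) cmor \<Rightarrow> ('n, 'u, 'v) cmor \<Rightarrow> ('n, 'u, 'w) cmor" where
  "chain_comp \<psi> \<phi> = (\<lambda>i. pmor_comp (\<psi> i) (\<phi> i))"

definition chain_homotopic ::
  "('k::field, 'n::finite, 'v::ab_group_add) cochain \<Rightarrow> ('k, 'n, 'w::ab_group_add) cochain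
    \<Rightarrow> ('n, 'v, 'w) cmor \<Rightarrow> ('n, 'v, 'w) cmor \<Rightarrow> bool" where
  "chain_homotopic X Y \<phi> \<psi> \<longleftrightarrow>
     (\<exists>h. (\<forall>i. h i \<in> pers_hom (obj X i) (obj Y (i - 1))) \<and>
          (\<forall>i s. \<forall>x\<in>fibre (obj X i) s.
             \<phi> i s x - \<psi> i s x = diff Y (i - 1) s (h i s x) + h (i + 1) s (diff X i s x)))"

definition homotopy_rel ::
  "('k::field, 'n::finite, 'v::ab_group_add) cochain \<Rightarrow> ('k, 'n, 'w::ab_group_add) cochain
    \<Rightarrow> (('n, 'v, 'w) cmor \<times> ('n, 'v, 'w) cmor) set" where
  "homotopy_rel X Y =
     {(\<phi>, \<psi>). \<phi> \<in> chain_hom X Y \<and> \<psi> \<in> chain_hom X Y \<and> chain_homotopic X Y \<phi> \<psi>}"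

definition K_hom ::
  "('k::field, 'n::finite, 'v::ab_group_add) cochain \<Rightarrow> ('k, 'n, 'w::ab_group_add) cochain
    \<Rightarrow> ('n, 'v, 'w) cmor set set" where
  "K_hom X Y = chain_hom X Y // homotopy_rel X Y"

definition K_class ::
  "('k::field, 'n::finite, 'v::ab_group_add) cochain \<Rightarrow> ('k, 'n, 'w::ab_group_add) cochain
    \<Rightarrow> ('n, 'v, 'w) cmor \<Rightarrow> ('n, 'v, 'w) cmor set" where
  "K_class X Y \<phi> = homotopy_rel X Y `` {\<phi>}"

text \<open>The class of \<open>\<psi> \<circ> \<phi>\<close> for any representatives \<open>\<psi>\<close> of \<open>G\<close> and \<open>\<phi>\<close> of \<open>F\<close>; all of them give
  the same class, so the union is over equal sets.\<close>

definition K_comp ::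
  "('k::field, 'n::finite, 'u::ab_group_add) cochain \<Rightarrow> ('k, 'n, 'w::ab_group_add) cochain
    \<Rightarrow> ('n, 'v, 'w) cmor set \<Rightarrow> ('n, 'u, 'v) cmor set \<Rightarrow> ('n, 'u, 'w) cmor set" where
  "K_comp X Z G F = (\<Union>\<psi>\<in>G. \<Union>\<phi>\<in>F. K_class X Z (chain_comp \<psi> \<phi>))"

definition K_minus_object ::
  "('k::field, 'n::finite, 'v::ab_group_add) cochain \<Rightarrow> bool" where
  "K_minus_object X \<longleftrightarrow>
     cochain_complex X \<and>
     (\<forall>i. finitely_presented (obj X i)) \<and>
     (\<exists>m. \<forall>i>m. \<forall>s. fibre (obj X i) s = {0})"

section \<open>Interleaving distances\<close>

definition pshift :: "real \<Rightarrow> ('k, 'n::finite, 'v) pers \<Rightarrow> ('k, 'n, 'v) pers" where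
  "pshift \<epsilon> M =
     \<lparr> fibre = (\<lambda>s. fibre M (s + vec \<epsilon>)),
       scl = scl M,
       tr = (\<lambda>s t. tr M (s + vec \<epsilon>) (t + vec \<epsilon>)) \<rparr>"

definition pmor_shift :: "real \<Rightarrow> ('n::finite, 'v, 'w) pmor \<Rightarrow> ('n, 'v, 'w) pmor" where
  "pmor_shift \<epsilon> f = (\<lambda>s. f (s + vec \<epsilon>))"

definition smoothing :: "real \<Rightarrow> ('k, 'n::finite, 'v) pers \<Rightarrow> ('n, 'v, 'v) pmor" where
  "smoothing \<epsilon> M = (\<lambda>s. tr M s (s + vec \<epsilon>))"

definition interleaved ::
  "real \<Rightarrow> ('k::field, 'n::finite, 'v::ab_group_add) pers \<Rightarrow> ('k, 'n, 'w::ab_group_add) pers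
    \<Rightarrow> bool" where
  "interleaved \<epsilon> M N \<longleftrightarrow>
     (\<exists>f\<in>pers_hom M (pshift \<epsilon> N). \<exists>g\<in>pers_hom N (pshift \<epsilon> M).
        pmor_eq M (pmor_comp (pmor_shift \<epsilon> g) f) (smoothing (2 * \<epsilon>) M) \<and>
        pmor_eq N (pmor_comp (pmor_shift \<epsilon> f) g) (smoothing (2 * \<epsilon>) N))"

definition d_I ::
  "('k::field, 'n::finite, 'v::ab_group_add) pers \<Rightarrow> ('k, 'n, 'w::ab_group_add) pers
    \<Rightarrow> ennreal" where
  "d_I M N = Inf {ennreal \<epsilon> | \<epsilon>. 0 \<le> \<epsilon> \<and> interleaved \<epsilon> M N}"

definition cshift :: "real \<Rightarrow> ('k, 'n::finite, 'v) cochain \<Rightarrow> ('k, 'n, 'v) cochain" where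
  "cshift \<epsilon> X = \<lparr> obj = (\<lambda>i. pshift \<epsilon> (obj X i)), diff = (\<lambda>i. pmor_shift \<epsilon> (diff X i)) \<rparr>"

definition cmor_shift :: "real \<Rightarrow> ('n::finite, 'v, 'w) cmor \<Rightarrow> ('n, 'v, 'w) cmor" where
  "cmor_shift \<epsilon> \<phi> = (\<lambda>i. pmor_shift \<epsilon> (\<phi> i))"

definition csmoothing :: "real \<Rightarrow> ('k, 'n::finite, 'v) cochain \<Rightarrow> ('n, 'v, 'v) cmor" where
  "csmoothing \<epsilon> X = (\<lambda>i. smoothing \<epsilon> (obj X i))"

text \<open>The morphism \<open>F[\<epsilon>] : X[\<epsilon>] \<rightarrow> Y[\<epsilon>]\<close> for \<open>F : X \<rightarrow> Y\<close> in the homotopy category.\<close>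

definition K_shift ::
  "('k::field, 'n::finite, 'v::ab_group_add) cochain \<Rightarrow> ('k, 'n, 'w::ab_group_add) cochain
    \<Rightarrow> real \<Rightarrow> ('n, 'v, 'w) cmor set \<Rightarrow> ('n, 'v, 'w) cmor set" where
  "K_shift X Y \<epsilon> F = (\<Union>\<phi>\<in>F. K_class (cshift \<epsilon> X) (cshift \<epsilon> Y) (cmor_shift \<epsilon> \<phi>))"

text \<open>As everywhere, \<open>X[\<epsilon>][\<epsilon>]\<close> and \<open>X[2\<epsilon>]\<close> are identified; here they are equal.\<close>

lemma cshift_cshift: "cshift \<epsilon> (cshift \<delta> X) = cshift (\<epsilon> + \<delta>) X"
  by (simp add: cshift_def pshift_def pmor_shift_def fun_eq_iff add.assoc vec_add)

definition K_interleaved ::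
  "real \<Rightarrow> ('k::field, 'n::finite, 'v::ab_group_add) cochain
    \<Rightarrow> ('k, 'n, 'w::ab_group_add) cochain \<Rightarrow> bool" where
  "K_interleaved \<epsilon> X Y \<longleftrightarrow>
     (\<exists>F\<in>K_hom X (cshift \<epsilon> Y). \<exists>G\<in>K_hom Y (cshift \<epsilon> X).
        K_comp X (cshift (2 * \<epsilon>) X) (K_shift Y (cshift \<epsilon> X) \<epsilon> G) F =
          K_class X (cshift (2 * \<epsilon>) X) (csmoothing (2 * \<epsilon>) X) \<and>
        K_comp Y (cshift (2 * \<epsilon>) Y) (K_shift X (cshift \<epsilon> Y) \<epsilon> F) G =
          K_class Y (cshift (2 * \<epsilon>) Y) (csmoothing (2 * \<epsilon>) Y))"

definition d_I_K ::
  "('k::field, 'n::finite, 'v::ab_group_add) cochain \<Rightarrow> ('k, 'n, 'w::ab_group_add) cochain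
    \<Rightarrow> ennreal" where
  "d_I_K X Y = Inf {ennreal \<epsilon> | \<epsilon>. 0 \<le> \<epsilon> \<and> K_interleaved \<epsilon> X Y}"

section \<open>Free resolutions are objects of $K^-(pers(R^n))$\<close>

lemma free_sum_simps:
  "v \<in> fibre (free_sum as) s \<longleftrightarrow> (\<forall>i. v i \<noteq> 0 \<longrightarrow> i < length as \<and> as ! i \<le> s)"
  "scl (free_sum as) c v i = c * v i"
  "tr (free_sum as) s t v i = (if i < length as \<and> as ! i \<le> s then v i else 0)"
  by (force simp: free_sum_def elementary_free_def not_less[symmetric])
     (simp_all add: free_sum_def elementary_free_def)

lemma persistence_module_free_sum:
  "persistence_module (free_sum as :: ('k::field, 'n::finite, nat \<Rightarrow> 'k) pers)"
proof -
  let ?F = "free_sum as :: ('k, 'n, nat \<Rightarrow> 'k) pers"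
  have vs: "vector_space (scl ?F)"
    by unfold_locales (simp_all add: fun_eq_iff free_sum_simps algebra_simps)
  interpret V: vector_space "scl ?F" by (rule vs)
  have tr_id: "tr ?F s t v = v" if "v \<in> fibre ?F s" for s t v
    using that by (auto simp: free_sum_simps fun_eq_iff)
  have mono: "v \<in> fibre ?F t" if "v \<in> fibre ?F s" "s \<le> t" for s t v
    using that unfolding free_sum_simps by (meson order_trans)
  have sub: "V.subspace (fibre ?F s)" for s
  proof (rule V.subspaceI)
    show "0 \<in> fibre ?F s" by (simp add: free_sum_simps)
  next
    fix x y assume "x \<in> fibre ?F s" "y \<in> fibre ?F s"
    then show "x + y \<in> fibre ?F s" unfolding free_sum_simps plus_fun_apply by (metis add_0)
  next
    fix c x assume "x \<in> fibre ?F s"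
    then show "scl ?F c x \<in> fibre ?F s" unfolding free_sum_simps by simp
  qed
  have lin: "linear_between (scl ?F) (scl ?F) (fibre ?F s) (fibre ?F t) (tr ?F s t)"
    if "s \<le> t" for s t
    unfolding linear_between_def
    by (simp add: tr_id V.subspace_add[OF sub] V.subspace_scale[OF sub] mono[OF _ that])
  show ?thesis
    unfolding persistence_module_def
    using vs sub lin tr_id mono by auto
qed

lemma pers_iso_refl: "pers_iso M M"
  unfolding pers_iso_def
  by (intro bexI[where x = pmor_id] conjI)
     (auto simp: pers_hom_def pmor_eq_def pmor_comp_def pmor_id_def linear_between_def)

lemma free_module_free_sum: "free_module (free_sum as)"
  unfolding free_module_def using persistence_module_free_sum pers_iso_refl by blast

lemma free_module_finitely_presented:
  assumes "free_module (M :: ('k::field, 'n::finite, 'v::ab_group_add) pers)"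
  shows "finitely_presented M"
proof -
  from assms obtain as f g where M: "persistence_module M"
    and f: "f \<in> pers_hom M (free_sum as)" and g: "g \<in> pers_hom (free_sum as) M"
    and gf: "pmor_eq M (pmor_comp g f) pmor_id"
    and fg: "pmor_eq (free_sum as) (pmor_comp f g) pmor_id"
    unfolding free_module_def pers_iso_def by blast
  let ?F0 = "free_sum as :: ('k, 'n, nat \<Rightarrow> 'k) pers"
  let ?F1 = "free_sum [] :: ('k, 'n, nat \<Rightarrow> 'k) pers"
  let ?p = "\<lambda>(s::real^'n) (v::nat \<Rightarrow> 'k). v"
  have F1: "fibre ?F1 s = {0}" for s
    by (auto simp: free_sum_simps fun_eq_iff)
  have F0: "0 \<in> fibre ?F0 s" for s
    by (simp add: free_sum_simps)
  have gM: "g s v \<in> fibre M s" if "v \<in> fibre ?F0 s" for s v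
    using g that by (auto simp: pers_hom_def linear_between_def)
  have fF: "f s x \<in> fibre ?F0 s" if "x \<in> fibre M s" for s x
    using f that by (auto simp: pers_hom_def linear_between_def)
  have gfx: "g s (f s x) = x" if "x \<in> fibre M s" for s x
    using gf that by (auto simp: pmor_eq_def pmor_comp_def pmor_id_def)
  have fgv: "f s (g s v) = v" if "v \<in> fibre ?F0 s" for s v
    using fg that by (auto simp: pmor_eq_def pmor_comp_def pmor_id_def)
  have g0: "g s 0 = 0" for s
  proof -
    have "g s (0 + 0) = g s 0 + g s 0"
      using g F0[of s] unfolding pers_hom_def linear_between_def by blast
    then show ?thesis by simp
  qed
  have p: "?p \<in> pers_hom ?F1 ?F0"
    using F0 by (simp add: pers_hom_def linear_between_def F1 fun_eq_iff free_sum_simps)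
  have im: "g s ` fibre ?F0 s = fibre M s" for s
    using gM fF gfx by (metis image_eqI image_subsetI subsetI subset_antisym)
  have ker: "{v\<in>fibre ?F0 s. g s v = 0} = ?p s ` fibre ?F1 s" for s
  proof -
    have "v = 0" if "v \<in> fibre ?F0 s" "g s v = 0" for v
      using fgv[OF that(1)] fgv[OF F0] that(2) g0 by metis
    then show ?thesis using F0 g0 by (auto simp: F1)
  qed
  have "is_cokernel ?F1 ?F0 ?p M g"
    unfolding is_cokernel_def using p g im ker by blast
  then show ?thesis
    unfolding finitely_presented_def using M free_module_free_sum by blast
qed

lemma free_resolution_K_minus_object: "free_resolution X M \<Longrightarrow> K_minus_object X"
  unfolding free_resolution_def K_minus_object_def
  by (simp add: free_module_finitely_presented) (rule exI[of _ 0], simp)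

end

theory Submission
  imports Defs
begin

text \<open>
  For free resolutions \<open>X\<close> of \<open>M\<close> and \<open>Y\<close> of \<open>N\<close>, the comparison theorem identifies
  \<open>K_hom X Y\<close> with \<open>pers_hom M N\<close>, a homotopy class being the set of all lifts of one
  morphism of modules.  The shift of a free resolution of \<open>M\<close> is a free resolution of the shift of
  \<open>M\<close>, and the smoothing chain map lifts the smoothing morphism.  Hence \<open>M\<close> and \<open>N\<close> are
  \<open>\<epsilon>\<close>-interleaved iff \<open>X\<close> and \<open>Y\<close> are, for every \<open>\<epsilon>\<close>.
\<close>

section \<open>Morphisms of persistence modules\<close>

lemma persistence_moduleD:
  assumes "persistence_module M"
  shows "vector_space (scl M)" "module.subspace (scl M) (fibre M s)"
    and "s \<le> t \<Longrightarrow> linear_between (scl M) (scl M) (fibre M s) (fibre M t) (tr M s t)"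
    and "x \<in> fibre M s \<Longrightarrow> tr M s s x = x"
    and "r \<le> s \<Longrightarrow> s \<le> t \<Longrightarrow> x \<in> fibre M r \<Longrightarrow> tr M s t (tr M r s x) = tr M r t x"
  using assms unfolding persistence_module_def by blast+

lemma module_of_persistence_module: "persistence_module M \<Longrightarrow> module (scl M)"
  using persistence_moduleD(1) by (auto simp: vector_space_def module_def)

lemma fibre_zero: "persistence_module M \<Longrightarrow> 0 \<in> fibre M s"
  using module.subspace_0[OF module_of_persistence_module] persistence_moduleD(2) by blast

lemma fibre_add:
  "persistence_module M \<Longrightarrow> x \<in> fibre M s \<Longrightarrow> y \<in> fibre M s \<Longrightarrow> x + y \<in> fibre M s"
  using module.subspace_add[OF module_of_persistence_module] persistence_moduleD(2) by blast

lemma fibre_diff: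
  "persistence_module M \<Longrightarrow> x \<in> fibre M s \<Longrightarrow> y \<in> fibre M s \<Longrightarrow> x - y \<in> fibre M s"
  using module.subspace_diff[OF module_of_persistence_module] persistence_moduleD(2) by blast

lemma fibre_scale: "persistence_module M \<Longrightarrow> x \<in> fibre M s \<Longrightarrow> scl M c x \<in> fibre M s"
  using module.subspace_scale[OF module_of_persistence_module] persistence_moduleD(2) by blast

lemma fibre_sum:
  "persistence_module M \<Longrightarrow> (\<And>i. i \<in> I \<Longrightarrow> f i \<in> fibre M s) \<Longrightarrow> sum f I \<in> fibre M s"
  by (induction I rule: infinite_finite_induct) (auto intro: fibre_zero fibre_add)

lemma linear_between_sum:
  assumes lin: "linear_between c c' (fibre M s) W g" and M: "persistence_module M"
    and f: "\<And>i. i \<in> I \<Longrightarrow> f i \<in> fibre M s"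
  shows "g (sum f I) = (\<Sum>i\<in>I. g (f i))"
proof -
  \<comment> \<open>Additivity forces \<open>g 0 = 0\<close>, which settles the empty sum and also
    the infinite one, whose value is 0 by convention.\<close>
  have "g (0 + 0) = g 0 + g 0"
    using lin fibre_zero[OF M, of s] unfolding linear_between_def by blast
  then have 0: "g 0 = 0" by simp
  have add: "g (x + y) = g x + g y" if "x \<in> fibre M s" "y \<in> fibre M s" for x y
    using lin that unfolding linear_between_def by blast
  show ?thesis
    using f
  proof (induction I rule: infinite_finite_induct)
    case (insert i I)
    then have "f i \<in> fibre M s" "sum f I \<in> fibre M s" by (auto intro: fibre_sum[OF M])
    with insert show ?case by (simp add: add)
  qed (simp_all add: 0)
qed

lemma tr_fibre: "persistence_module M \<Longrightarrow> s \<le> t \<Longrightarrow> x \<in> fibre M s \<Longrightarrow> tr M s t x \<in> fibre M t"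
  using persistence_moduleD(3) unfolding linear_between_def by blast

lemma tr_scale:
  "persistence_module M \<Longrightarrow> s \<le> t \<Longrightarrow> x \<in> fibre M s \<Longrightarrow> tr M s t (scl M c x) = scl M c (tr M s t x)"
  using persistence_moduleD(3) unfolding linear_between_def by blast

lemma tr_add:
  "persistence_module M \<Longrightarrow> s \<le> t \<Longrightarrow> x \<in> fibre M s \<Longrightarrow> y \<in> fibre M s
    \<Longrightarrow> tr M s t (x + y) = tr M s t x + tr M s t y"
  using persistence_moduleD(3) unfolding linear_between_def by blast

lemma tr_sum:
  "persistence_module M \<Longrightarrow> s \<le> t \<Longrightarrow> (\<And>i. i \<in> I \<Longrightarrow> f i \<in> fibre M s)
    \<Longrightarrow> tr M s t (sum f I) = (\<Sum>i\<in>I. tr M s t (f i))"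
  using linear_between_sum persistence_moduleD(3) by blast

lemma tr_diff:
  assumes "persistence_module M" "s \<le> t" "x \<in> fibre M s" "y \<in> fibre M s"
  shows "tr M s t (x - y) = tr M s t x - tr M s t y"
  using tr_add[OF assms(1,2) fibre_diff[OF assms(1,3,4)] assms(4)] by (simp add: algebra_simps)

lemma tr_zero: "persistence_module M \<Longrightarrow> s \<le> t \<Longrightarrow> tr M s t 0 = 0"
  using tr_diff[of M s t 0 0] by (simp add: fibre_zero)

section \<open>Pointwise calculus of morphisms\<close>

lemma pers_homI:
  assumes "\<And>s x. x \<in> fibre M s \<Longrightarrow> f s x \<in> fibre N s"
    and "\<And>s x y. x \<in> fibre M s \<Longrightarrow> y \<in> fibre M s \<Longrightarrow> f s (x + y) = f s x + f s y"
    and "\<And>s c x. x \<in> fibre M s \<Longrightarrow> f s (scl M c x) = scl N c (f s x)"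
    and "\<And>s t x. s \<le> t \<Longrightarrow> x \<in> fibre M s \<Longrightarrow> f t (tr M s t x) = tr N s t (f s x)"
  shows "f \<in> pers_hom M N"
  using assms unfolding pers_hom_def linear_between_def by blast

lemma pers_homD:
  assumes "f \<in> pers_hom M N"
  shows "x \<in> fibre M s \<Longrightarrow> f s x \<in> fibre N s"
    and "x \<in> fibre M s \<Longrightarrow> y \<in> fibre M s \<Longrightarrow> f s (x + y) = f s x + f s y"
    and "x \<in> fibre M s \<Longrightarrow> f s (scl M c x) = scl N c (f s x)"
    and "s \<le> t \<Longrightarrow> x \<in> fibre M s \<Longrightarrow> f t (tr M s t x) = tr N s t (f s x)"
  using assms unfolding pers_hom_def linear_between_def by blast+

lemma pers_hom_diff:
  assumes "f \<in> pers_hom M N" "persistence_module M" "x \<in> fibre M s" "y \<in> fibre M s"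
  shows "f s (x - y) = f s x - f s y"
  using pers_homD(2)[OF assms(1) fibre_diff[OF assms(2-4)] assms(4)] by (simp add: algebra_simps)

lemma pers_hom_zero: "f \<in> pers_hom M N \<Longrightarrow> persistence_module M \<Longrightarrow> f s 0 = 0"
  using pers_hom_diff[of f M N 0 s 0] by (simp add: fibre_zero)

lemma pers_hom_sum:
  assumes "f \<in> pers_hom M N" "persistence_module M" "\<And>i. i \<in> I \<Longrightarrow> u i \<in> fibre M s"
  shows "f s (sum u I) = (\<Sum>i\<in>I. f s (u i))"
  using linear_between_sum assms unfolding pers_hom_def by blast

lemma pers_hom_pmor_comp:
  "f \<in> pers_hom L M \<Longrightarrow> g \<in> pers_hom M N \<Longrightarrow> pmor_comp g f \<in> pers_hom L N"
  unfolding pmor_comp_def by (rule pers_homI) (simp_all add: pers_homD)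

lemma zero_pers_hom: "persistence_module N \<Longrightarrow> (\<lambda>s x. 0) \<in> pers_hom M N"
  by (rule pers_homI)
     (simp_all add: fibre_zero tr_zero module.scale_zero_right[OF module_of_persistence_module])

lemma minus_pers_hom:
  assumes "f \<in> pers_hom M N" "g \<in> pers_hom M N" "persistence_module N"
  shows "(\<lambda>s x. f s x - g s x) \<in> pers_hom M N"
  by (rule pers_homI)
     (simp_all add: pers_homD[OF assms(1)] pers_homD[OF assms(2)] fibre_diff[OF assms(3)]
        tr_diff[OF assms(3)] module.scale_right_diff_distrib[OF module_of_persistence_module[OF assms(3)]])

text \<open>Universal property of the quotient: \<open>e\<close> is pointwise onto, hence presents
  \<open>M\<close> as \<open>P\<close> modulo the kernel of \<open>e\<close>, and \<open>g\<close>
  kills that kernel.\<close>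

lemma pers_hom_factor:
  assumes P: "persistence_module P" and e: "e \<in> pers_hom P M" and g: "g \<in> pers_hom P N"
    and surj: "\<And>s. e s ` fibre P s = fibre M s"
    and ker: "\<And>s x. x \<in> fibre P s \<Longrightarrow> e s x = 0 \<Longrightarrow> g s x = 0"
  obtains f where "f \<in> pers_hom M N" "\<And>s x. x \<in> fibre P s \<Longrightarrow> f s (e s x) = g s x"
proof -
  \<comment> \<open>An arbitrary preimage under \<open>e\<close> is chosen in each fibre; once
    \<open>fe\<close> shows independence of the choice, linearity and naturality are inherited from
    \<open>g\<close> and \<open>e\<close>.\<close>
  define f where "f = (\<lambda>s y. g s (SOME x. x \<in> fibre P s \<and> e s x = y))"
  have fe: "f s (e s x) = g s x" if x: "x \<in> fibre P s" for s x
  proof -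
    define x' where "x' = (SOME x'. x' \<in> fibre P s \<and> e s x' = e s x)"
    have x': "x' \<in> fibre P s \<and> e s x' = e s x"
      unfolding x'_def by (rule someI[of _ x]) (simp add: x)
    \<comment> \<open>Two preimages of the same element differ by an element of the kernel of
      \<open>e\<close>.\<close>
    then have "g s (x' - x) = 0"
      using x by (intro ker) (simp_all add: fibre_diff[OF P] pers_hom_diff[OF e P])
    then show ?thesis
      using x x' by (simp add: pers_hom_diff[OF g P] f_def x'_def[symmetric])
  qed
  have pre: "\<exists>x\<in>fibre P s. y = e s x" if "y \<in> fibre M s" for s y
    using surj[of s] that by blast
  have "f \<in> pers_hom M N"
  proof (rule pers_homI)
    show "f s y \<in> fibre N s" if "y \<in> fibre M s" for s y
      using pre[OF that] fe pers_homD(1)[OF g] by metis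
    show "f s (y + z) = f s y + f s z" if "y \<in> fibre M s" "z \<in> fibre M s" for s y z
      using pre[OF that(1)] pre[OF that(2)] fe pers_homD(2)[OF g] pers_homD(2)[OF e] fibre_add[OF P]
      by metis
    show "f s (scl M c y) = scl N c (f s y)" if "y \<in> fibre M s" for s c y
      using pre[OF that] fe pers_homD(3)[OF g] pers_homD(3)[OF e] fibre_scale[OF P] by metis
    show "f t (tr M s t y) = tr N s t (f s y)" if "s \<le> t" "y \<in> fibre M s" for s t y
      using pre[OF that(2)] fe pers_homD(4)[OF g that(1)] pers_homD(4)[OF e that(1)]
        tr_fibre[OF P that(1)] by metis
  qed
  then show thesis using fe that by blast
qed

section \<open>Projectivity of free modules\<close>

lemma sum_fun_apply: "sum f I x = (\<Sum>i\<in>I. f i x)"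
  for f :: "'i \<Rightarrow> 'a \<Rightarrow> 'b::comm_monoid_add"
  by (induction I rule: infinite_finite_induct) simp_all

text \<open>By Yoneda, a morphism out of $F_a$ amounts to an element of the fibre at
  \<open>a\<close>, the image of the generator. So it is enough to choose, for each summand, a
  preimage under \<open>g\<close> of the image of its generator, and to extend linearly and along
  the transition maps.\<close>

lemma free_sum_lift:
  fixes A :: "('k::field, 'n::finite, 'v::ab_group_add) pers"
  assumes A: "persistence_module A" and B: "persistence_module B"
    and g: "g \<in> pers_hom A B" and f: "f \<in> pers_hom (free_sum as) B"
    and im: "\<And>s x. x \<in> fibre (free_sum as) s \<Longrightarrow> f s x \<in> g s ` fibre A s"
  obtains h where "h \<in> pers_hom (free_sum as) A"
    "\<And>s x. x \<in> fibre (free_sum as) s \<Longrightarrow> g s (h s x) = f s x"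
proof -
  let ?F = "free_sum as :: ('k, 'n, nat \<Rightarrow> 'k) pers"
  let ?I = "{..<length as}"
  \<comment> \<open>The generator of the \<open>i\<close>-th summand, which belongs to the fibre at
    \<open>s\<close> as soon as \<open>as ! i \<le> s\<close>.\<close>
  let ?u = "\<lambda>(i::nat) (j::nat). if j = i then (1::'k) else 0"
  interpret VA: vector_space "scl A" using A by (rule persistence_moduleD)
  interpret VB: vector_space "scl B" using B by (rule persistence_moduleD)
  have F: "persistence_module ?F" by (rule persistence_module_free_sum)
  have u: "?u i \<in> fibre ?F s" if "i < length as" "as ! i \<le> s" for i s
    using that by (auto simp: free_sum_simps)
  have "\<exists>a\<in>fibre A (as ! i). g (as ! i) a = f (as ! i) (?u i)" if "i < length as" for i
    using im[OF u[OF that order_refl]] by (auto simp: image_iff)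
  then obtain a where a: "\<And>i. i < length as \<Longrightarrow> a i \<in> fibre A (as ! i)"
    and ga: "\<And>i. i < length as \<Longrightarrow> g (as ! i) (a i) = f (as ! i) (?u i)"
    by metis
  \<comment> \<open>The contribution of the \<open>i\<close>-th summand. If
    \<open>as ! i \<le> s\<close> fails, the transition map carries no meaning, but then
    \<open>v i = 0\<close> on the fibre and the term is 0.\<close>
  define m where "m s v i = scl A (v i) (tr A (as ! i) s (a i))" for s v i
  define h where "h s v = (\<Sum>i<length as. m s v i)" for s v
  have v0: "v i = 0" if "v \<in> fibre ?F s" "\<not> as ! i \<le> s" for v i s
    using that by (auto simp: free_sum_simps)
  have m: "m s v i \<in> fibre A s" if "v \<in> fibre ?F s" "i \<in> ?I" for s v i
    using v0[OF that(1), of i] that a[of i]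
    by (cases "as ! i \<le> s") (auto simp: m_def fibre_zero[OF A] intro!: fibre_scale[OF A] tr_fibre[OF A])
  have "h \<in> pers_hom ?F A"
  proof (rule pers_homI)
    show "h s v \<in> fibre A s" if "v \<in> fibre ?F s" for s v
      unfolding h_def using m[OF that] by (rule fibre_sum[OF A])
    show "h s (v + w) = h s v + h s w" for s v w
      by (simp add: h_def m_def VA.scale_left_distrib sum.distrib)
    show "h s (scl ?F c v) = scl A c (h s v)" for s c v
      by (simp add: h_def m_def free_sum_simps VA.scale_sum_right)
    show "h t (tr ?F s t v) = tr A s t (h s v)" if st: "s \<le> t" and v: "v \<in> fibre ?F s" for s t v
    proof -
      have "m t (tr ?F s t v) i = tr A s t (m s v i)" if "i \<in> ?I" for i
      proof (cases "as ! i \<le> s")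
        case True
        then show ?thesis
          using that st a[of i]
          by (simp add: m_def free_sum_simps tr_scale[OF A] tr_fibre[OF A] persistence_moduleD(5)[OF A])
      next
        case False
        then show ?thesis
          using v0[OF v False] by (simp add: m_def free_sum_simps tr_zero[OF A st])
      qed
      then show ?thesis
        unfolding h_def using tr_sum[OF A st, of ?I "m s v"] m[OF v] by simp
    qed
  qed
  moreover have "g s (h s v) = f s v" if v: "v \<in> fibre ?F s" for s v
  proof -
    \<comment> \<open>The decomposition of \<open>v\<close> into multiples of generators. Generators
      not yet born at \<open>s\<close> are replaced by 0, so that every term lies in the fibre at
      \<open>s\<close>; their coefficients vanish anyway.\<close>
    let ?w = "\<lambda>i. scl ?F (v i) (if as ! i \<le> s then ?u i else 0)"
    have w: "?w i \<in> fibre ?F s" if "i \<in> ?I" for i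
      using u[of i s] that by (auto intro!: fibre_scale[OF F] simp: fibre_zero[OF F])
    have "g s (m s v i) = f s (?w i)" if i: "i \<in> ?I" for i
    proof (cases "as ! i \<le> s")
      case True
      have i': "i < length as" using i by simp
      then have "tr ?F (as ! i) s (?u i) = ?u i"
        by (auto simp: free_sum_simps fun_eq_iff)
      \<comment> \<open>Naturality of \<open>g\<close> and \<open>f\<close> carries the equation
        \<open>ga\<close> from \<open>as ! i\<close> up to \<open>s\<close>.\<close>
      then have "g s (tr A (as ! i) s (a i)) = f s (?u i)"
        using pers_homD(4)[OF g True a[OF i']] ga[OF i']
          pers_homD(4)[OF f True u[OF i' order_refl]] by simp
      then show ?thesis
        using i True a[of i] u[of i s]
        by (simp add: m_def pers_homD(3)[OF g] pers_homD(3)[OF f] tr_fibre[OF A])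
    next
      case False
      then show ?thesis
        using v0[OF v False] pers_hom_zero[OF g A] pers_hom_zero[OF f F]
        by (simp add: m_def module.scale_zero_left[OF module_of_persistence_module[OF F]])
    qed
    moreover have "v = sum ?w ?I"
    proof
      fix j
      have "?w i j = (if j = i then v j else 0)" for i
        using v by (auto simp: free_sum_simps)
      moreover have "v j = 0" if "\<not> j < length as"
        using v that by (auto simp: free_sum_simps)
      ultimately show "v j = sum ?w ?I j"
        by (simp add: sum_fun_apply)
    qed
    moreover have "g s (h s v) = (\<Sum>i\<in>?I. g s (m s v i))"
      unfolding h_def using m[OF v] by (rule pers_hom_sum[OF g A])
    moreover have "f s (sum ?w ?I) = (\<Sum>i\<in>?I. f s (?w i))"
      using w by (rule pers_hom_sum[OF f F])
    ultimately show ?thesis by simp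
  qed
  ultimately show thesis using that by blast
qed

text \<open>\<open>P\<close> is a retract of some \<open>free_sum as\<close> by \<open>a\<close> and
  \<open>b\<close>: lift \<open>f\<close> after \<open>b\<close> on the direct sum and precompose
  with \<open>a\<close>.\<close>

lemma free_module_lift:
  assumes P: "free_module P" and A: "persistence_module A" and B: "persistence_module B"
    and g: "g \<in> pers_hom A B" and f: "f \<in> pers_hom P B"
    and im: "\<And>s x. x \<in> fibre P s \<Longrightarrow> f s x \<in> g s ` fibre A s"
  obtains h where "h \<in> pers_hom P A" "\<And>s x. x \<in> fibre P s \<Longrightarrow> g s (h s x) = f s x"
proof -
  from P obtain as a b where a: "a \<in> pers_hom P (free_sum as)" and b: "b \<in> pers_hom (free_sum as) P"
    and ba: "pmor_eq P (pmor_comp b a) pmor_id"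
    unfolding free_module_def pers_iso_def by blast
  have "pmor_comp f b s x \<in> g s ` fibre A s" if "x \<in> fibre (free_sum as) s" for s x
    using im[OF pers_homD(1)[OF b that]] by (simp add: pmor_comp_def)
  then obtain h where h: "h \<in> pers_hom (free_sum as) A"
    and gh: "\<And>s x. x \<in> fibre (free_sum as) s \<Longrightarrow> g s (h s x) = pmor_comp f b s x"
    using free_sum_lift[OF A B g pers_hom_pmor_comp[OF b f]] by blast
  show thesis
  proof (rule that)
    show "pmor_comp h a \<in> pers_hom P A" using a h by (rule pers_hom_pmor_comp)
    show "g s (pmor_comp h a s x) = f s x" if "x \<in> fibre P s" for s x
      using ba that gh[OF pers_homD(1)[OF a that]]
      by (simp add: pmor_eq_def pmor_comp_def pmor_id_def)
  qed
qed

section \<open>Comparison of augmented complexes\<close>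

text \<open>The augmentation \<open>e\<close> is named so that lifting a morphism can be stated with
  respect to it. Freeness is kept as a separate assumption, to be placed on the source of the chain
  maps.\<close>

definition augmented_resolution ::
  "('k::field, 'n::finite, 'v::ab_group_add) cochain \<Rightarrow> ('k, 'n, 'w::ab_group_add) pers
    \<Rightarrow> ('n, 'v, 'w) pmor \<Rightarrow> bool" where
  "augmented_resolution X M e \<longleftrightarrow>
     cochain_complex X \<and> (\<forall>i>0. \<forall>s. fibre (obj X i) s = {0}) \<and>
     (\<forall>i. i \<noteq> 0 \<longrightarrow> (\<forall>s. cocycles X i s = coboundaries X i s)) \<and>
     persistence_module M \<and> e \<in> pers_hom (obj X 0) M \<and>
     (\<forall>s. e s ` fibre (obj X 0) s = fibre M s \<and>
          {x\<in>fibre (obj X 0) s. e s x = 0} = coboundaries X 0 s)"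

lemma cochain_complexD:
  assumes "cochain_complex X"
  shows "persistence_module (obj X i)" "diff X i \<in> pers_hom (obj X i) (obj X (i + 1))"
    and "x \<in> fibre (obj X i) s \<Longrightarrow> diff X (i + 1) s (diff X i s x) = 0"
  using assms unfolding cochain_complex_def by blast+

lemma augmented_resolutionD:
  assumes "augmented_resolution X M e"
  shows "persistence_module (obj X i)" "diff X i \<in> pers_hom (obj X i) (obj X (i + 1))"
    and "x \<in> fibre (obj X i) s \<Longrightarrow> diff X (i + 1) s (diff X i s x) = 0"
    and "i > 0 \<Longrightarrow> fibre (obj X i) s = {0}"
    and "i \<noteq> 0 \<Longrightarrow> x \<in> fibre (obj X i) s \<Longrightarrow> diff X i s x = 0 \<Longrightarrow> x \<in> coboundaries X i s"
    and "persistence_module M" "e \<in> pers_hom (obj X 0) M"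
    and "e s ` fibre (obj X 0) s = fibre M s"
    and "x \<in> fibre (obj X 0) s \<Longrightarrow> e s x = 0 \<Longrightarrow> x \<in> coboundaries X 0 s"
    and "x \<in> fibre (obj X (- 1)) s \<Longrightarrow> e s (diff X (- 1) s x) = 0"
proof -
  have c: "cochain_complex X"
    and ex: "i \<noteq> 0 \<Longrightarrow> cocycles X i s = coboundaries X i s"
    and ker: "{x\<in>fibre (obj X 0) s. e s x = 0} = coboundaries X 0 s" for i s
    using assms unfolding augmented_resolution_def by auto
  from c show "persistence_module (obj X i)" "diff X i \<in> pers_hom (obj X i) (obj X (i + 1))"
    "x \<in> fibre (obj X i) s \<Longrightarrow> diff X (i + 1) s (diff X i s x) = 0"
    by (rule cochain_complexD)+
  show "i > 0 \<Longrightarrow> fibre (obj X i) s = {0}" "persistence_module M" "e \<in> pers_hom (obj X 0) M"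
    "e s ` fibre (obj X 0) s = fibre M s"
    using assms unfolding augmented_resolution_def by auto
  show "x \<in> coboundaries X i s" if "i \<noteq> 0" "x \<in> fibre (obj X i) s" "diff X i s x = 0"
    using that ex by (auto simp: cocycles_def)
  show "x \<in> coboundaries X 0 s" if "x \<in> fibre (obj X 0) s" "e s x = 0"
    using that ker by blast
  show "e s (diff X (- 1) s x) = 0" if "x \<in> fibre (obj X (- 1)) s"
    using that ker[of s] by (auto simp: coboundaries_def)
qed

text \<open>Since the complex vanishes in degree 1, every element of degree 0 is a cocycle. The map
  onto \<open>M\<close> supplied by \<open>cohomology_iso\<close> is therefore defined on the whole
  of \<open>obj X 0\<close> and serves as augmentation.\<close>

lemma free_resolution_augmented:
  assumes X: "free_resolution X M" and M: "persistence_module M"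
  obtains e where "augmented_resolution X M e"
proof -
  have c: "cochain_complex X" and z: "\<And>i s. i > 0 \<Longrightarrow> fibre (obj X i) s = {0}"
    using X unfolding free_resolution_def by auto
  have "diff X 0 s x = 0" if "x \<in> fibre (obj X 0) s" for s x
    using pers_homD(1)[OF cochain_complexD(2)[OF c, of 0] that] z[of 1 s] by simp
  then have cyc: "cocycles X 0 = fibre (obj X 0)"
    unfolding cocycles_def by (intro ext) auto
  have "obj X 0 \<lparr> fibre := fibre (obj X 0) \<rparr> = obj X 0" by simp
  then obtain e where "e \<in> pers_hom (obj X 0) M"
    "\<forall>s. e s ` fibre (obj X 0) s = fibre M s \<and>
      {x\<in>fibre (obj X 0) s. e s x = 0} = coboundaries X 0 s"
    using X unfolding free_resolution_def cohomology_iso_def cyc by auto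
  then have "augmented_resolution X M e"
    using X M unfolding augmented_resolution_def free_resolution_def by simp
  then show thesis by (rule that)
qed

section \<open>Chain maps over a morphism of modules\<close>

text \<open>The augmentations are \<open>d\<close> on \<open>X\<close> and \<open>e\<close> on
  \<open>Y\<close>. For augmented resolutions with free source, this set will turn out to be exactly
  one homotopy class.\<close>

definition lifts ::
  "('k::field, 'n::finite, 'a::ab_group_add) cochain \<Rightarrow> ('k, 'n, 'b::ab_group_add) cochain
    \<Rightarrow> ('n, 'a, 'v) pmor \<Rightarrow> ('n, 'b, 'w) pmor \<Rightarrow> ('n, 'v, 'w) pmor \<Rightarrow> ('n, 'a, 'b) cmor set" where
  "lifts X Y d e f =
     {\<phi> \<in> chain_hom X Y. \<forall>s. \<forall>x\<in>fibre (obj X 0) s. e s (\<phi> 0 s x) = f s (d s x)}"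

lemma chain_homD:
  assumes "\<phi> \<in> chain_hom X Y"
  shows "\<phi> i \<in> pers_hom (obj X i) (obj Y i)"
    and "x \<in> fibre (obj X i) s \<Longrightarrow> \<phi> (i + 1) s (diff X i s x) = diff Y i s (\<phi> i s x)"
  using assms unfolding chain_hom_def by blast+

text \<open>The morphism is the one induced on $H^0$: \<open>\<phi>\<close> maps coboundaries of
  degree 0, which form the kernel of \<open>d\<close>, to coboundaries, which \<open>e\<close>
  kills, so \<open>e\<close> after \<open>\<phi> 0\<close> factors through \<open>d\<close>.\<close>

lemma chain_hom_lifts:
  assumes X: "augmented_resolution X M d" and Y: "augmented_resolution Y N e"
    and \<phi>: "\<phi> \<in> chain_hom X Y"
  obtains f where "f \<in> pers_hom M N" "\<phi> \<in> lifts X Y d e f"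
proof -
  note X = augmented_resolutionD[OF X] and Y = augmented_resolutionD[OF Y]
  have "pmor_comp e (\<phi> 0) s x = 0" if x: "x \<in> fibre (obj X 0) s" "d s x = 0" for s x
  proof -
    obtain z where z: "z \<in> fibre (obj X (- 1)) s" "x = diff X (- 1) s z"
      using X(9)[OF x] by (auto simp: coboundaries_def)
    have "\<phi> 0 s x = diff Y (- 1) s (\<phi> (- 1) s z)"
      using chain_homD(2)[OF \<phi> z(1)] z(2) by simp
    then show ?thesis
      using Y(10)[OF pers_homD(1)[OF chain_homD(1)[OF \<phi>] z(1)]] by (simp add: pmor_comp_def)
  qed
  then obtain f where "f \<in> pers_hom M N"
    "\<And>s x. x \<in> fibre (obj X 0) s \<Longrightarrow> f s (d s x) = pmor_comp e (\<phi> 0) s x"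
    using pers_hom_factor[OF X(1,7) pers_hom_pmor_comp[OF chain_homD(1)[OF \<phi>] Y(7)] X(8)] by blast
  with \<phi> show thesis by (intro that[of f]) (simp_all add: lifts_def pmor_comp_def)
qed

text \<open>Existence half of the comparison theorem. The components are built downwards from degree
  0, each by projectivity of \<open>obj X i\<close> and exactness of the augmented complex
  \<open>Y\<close>.\<close>

lemma lifts_nonempty:
  assumes X: "augmented_resolution X M d" and Y: "augmented_resolution Y N e"
    and free: "\<And>i. free_module (obj X i)" and f: "f \<in> pers_hom M N"
  shows "lifts X Y d e f \<noteq> {}"
proof -
  note X = augmented_resolutionD[OF X] and Y = augmented_resolutionD[OF Y]
  \<comment> \<open>\<open>P n p\<close> says that \<open>p\<close> can serve in degree
    \<open>- n\<close>. The clause for \<open>n = 0\<close> ties the top component to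
    \<open>f\<close>; the last clause is the invariant that makes the next lift possible.
    \<open>Q\<close> is the chain map equation linking consecutive components.\<close>
  define P where "P n p \<longleftrightarrow> p \<in> pers_hom (obj X (- int n)) (obj Y (- int n)) \<and>
      (n = 0 \<longrightarrow> (\<forall>s. \<forall>x\<in>fibre (obj X 0) s. e s (p s x) = f s (d s x))) \<and>
      (\<forall>s. \<forall>x\<in>fibre (obj X (- 1 - int n)) s.
         p s (diff X (- 1 - int n) s x) \<in> coboundaries Y (- int n) s)" for n p
  define Q where "Q n p q \<longleftrightarrow> (\<forall>s. \<forall>x\<in>fibre (obj X (- 1 - int n)) s.
      p s (diff X (- 1 - int n) s x) = diff Y (- 1 - int n) s (q s x))" for n p q
  have idx: "- int n - 1 = - 1 - int n" "- int n - 2 = - 2 - int n" for n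
    by simp_all
  have dX: "diff X (- 1 - int n) \<in> pers_hom (obj X (- 1 - int n)) (obj X (- int n))" for n
    using X(2)[of "- 1 - int n"] by simp
  have dY: "diff Y (- 1 - int n) \<in> pers_hom (obj Y (- 1 - int n)) (obj Y (- int n))" for n
    using Y(2)[of "- 1 - int n"] by simp
  have ddX: "diff X (- 1 - int n) s (diff X (- 2 - int n) s x) = 0"
    if "x \<in> fibre (obj X (- 2 - int n)) s" for n s x
    using X(3)[OF that] by simp
  have dX2: "diff X (- 2 - int n) \<in> pers_hom (obj X (- 2 - int n)) (obj X (- 1 - int n))" for n
    using X(2)[of "- 2 - int n"] by simp
  have "\<exists>p. P 0 p"
  proof -
    have "pmor_comp f d s x \<in> e s ` fibre (obj Y 0) s" if "x \<in> fibre (obj X 0) s" for s x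
      using Y(8) pers_homD(1)[OF f pers_homD(1)[OF X(7) that]] by (simp add: pmor_comp_def)
    then obtain p where p: "p \<in> pers_hom (obj X 0) (obj Y 0)"
      and ep: "\<And>s x. x \<in> fibre (obj X 0) s \<Longrightarrow> e s (p s x) = pmor_comp f d s x"
      using free_module_lift[OF free Y(1,6,7) pers_hom_pmor_comp[OF X(7) f]] by blast
    \<comment> \<open>Applying \<open>e\<close> gives \<open>f\<close> of \<open>d\<close> of a
      coboundary, which is 0; exactness at degree 0 does the rest.\<close>
    have "p s (diff X (- 1) s x) \<in> coboundaries Y 0 s" if x: "x \<in> fibre (obj X (- 1)) s" for s x
    proof (rule Y(9))
      have dx: "diff X (- 1) s x \<in> fibre (obj X 0) s"
        using pers_homD(1)[OF dX[of 0]] x by simp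
      show "p s (diff X (- 1) s x) \<in> fibre (obj Y 0) s" using dx by (rule pers_homD(1)[OF p])
      show "e s (p s (diff X (- 1) s x)) = 0"
        using ep[OF dx] X(10)[OF x] pers_hom_zero[OF f X(6)] by (simp add: pmor_comp_def)
    qed
    with p ep show ?thesis by (auto simp: P_def pmor_comp_def)
  qed
  moreover have "\<exists>q. P (Suc n) q \<and> Q n p q" if p: "P n p" for p n
  proof -
    have ph: "p \<in> pers_hom (obj X (- int n)) (obj Y (- int n))" using p by (simp add: P_def)
    have "pmor_comp p (diff X (- 1 - int n)) s x \<in> diff Y (- 1 - int n) s ` fibre (obj Y (- 1 - int n)) s"
      if "x \<in> fibre (obj X (- 1 - int n)) s" for s x
      using p that by (simp add: P_def pmor_comp_def coboundaries_def idx)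
    then obtain q where q: "q \<in> pers_hom (obj X (- 1 - int n)) (obj Y (- 1 - int n))"
      and dq: "\<And>s x. x \<in> fibre (obj X (- 1 - int n)) s \<Longrightarrow>
        diff Y (- 1 - int n) s (q s x) = pmor_comp p (diff X (- 1 - int n)) s x"
      using free_module_lift[OF free Y(1) Y(1) dY pers_hom_pmor_comp[OF dX ph]] by blast
    \<comment> \<open>The invariant one degree lower: \<open>diff Y\<close> after \<open>q\<close>
      is \<open>p\<close> after \<open>diff X\<close>, and two successive differentials of
      \<open>X\<close> compose to 0, so the element is a cocycle in a nonzero degree.\<close>
    have "q s (diff X (- 2 - int n) s x) \<in> coboundaries Y (- 1 - int n) s"
      if x: "x \<in> fibre (obj X (- 2 - int n)) s" for s x
    proof (rule Y(5))
      have dx: "diff X (- 2 - int n) s x \<in> fibre (obj X (- 1 - int n)) s"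
        using x by (rule pers_homD(1)[OF dX2])
      show "q s (diff X (- 2 - int n) s x) \<in> fibre (obj Y (- 1 - int n)) s"
        using dx by (rule pers_homD(1)[OF q])
      show "diff Y (- 1 - int n) s (q s (diff X (- 2 - int n) s x)) = 0"
        using dq[OF dx] ddX[OF x] pers_hom_zero[OF ph X(1)] by (simp add: pmor_comp_def)
    qed simp
    with q dq show ?thesis
      by (intro exI[of _ q]) (simp add: P_def Q_def pmor_comp_def idx)
  qed
  ultimately obtain p where P: "\<And>n. P n (p n)" and Q: "\<And>n. Q n (p n) (p (Suc n))"
    using dependent_nat_choice[of P Q] by blast
  \<comment> \<open>In positive degrees the fibres are trivial and the zero morphism is the
    component.\<close>
  define \<phi> where "\<phi> i = (if i \<le> 0 then p (nat (- i)) else (\<lambda>s x. 0))" for i :: int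
  have \<phi>: "\<phi> i \<in> pers_hom (obj X i) (obj Y i)" for i
    using P[of "nat (- i)"] zero_pers_hom[OF Y(1)] by (cases "i \<le> 0") (simp_all add: \<phi>_def P_def)
  have "\<phi> (i + 1) s (diff X i s x) = diff Y i s (\<phi> i s x)" if x: "x \<in> fibre (obj X i) s" for i s x
  proof (cases "i < 0")
    case True
    define n where "n = nat (- i - 1)"
    have i: "i = - 1 - int n" using True by (simp add: n_def)
    have "nat (- i) = Suc n" "nat (- (i + 1)) = n" using i by auto
    then show ?thesis
      using Q[of n] x i by (auto simp: \<phi>_def Q_def)
  next
    case False
    \<comment> \<open>For \<open>i \<ge> 0\<close> both differentials end in degree
      \<open>i + 1 > 0\<close>, where the fibres are trivial.\<close>
    have "diff X i s x = 0"
      using pers_homD(1)[OF X(2) x] X(4)[of "i + 1" s] False by simp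
    moreover have "diff Y i s (\<phi> i s x) = 0"
      using pers_homD(1)[OF Y(2) pers_homD(1)[OF \<phi> x]] Y(4)[of "i + 1" s] False by simp
    ultimately show ?thesis using pers_hom_zero[OF \<phi> X(1)] by simp
  qed
  moreover have "\<forall>s. \<forall>x\<in>fibre (obj X 0) s. e s (\<phi> 0 s x) = f s (d s x)"
    using P[of 0] by (simp add: P_def \<phi>_def)
  ultimately have "\<phi> \<in> lifts X Y d e f"
    using \<phi> by (simp add: lifts_def chain_hom_def)
  then show ?thesis by blast
qed

section \<open>Homotopy is detected by the augmentation\<close>

text \<open>The differential of \<open>X\<close> out of degree 0 vanishes, so in degree 0 homotopic
  maps differ by a coboundary of \<open>Y\<close>, and \<open>e\<close> kills coboundaries.\<close>

lemma chain_homotopic_augmentation: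
  assumes X: "augmented_resolution X M d" and Y: "augmented_resolution Y N e"
    and \<phi>: "\<phi> \<in> chain_hom X Y" and \<psi>: "\<psi> \<in> chain_hom X Y" and hom: "chain_homotopic X Y \<phi> \<psi>"
    and x: "x \<in> fibre (obj X 0) s"
  shows "e s (\<phi> 0 s x) = e s (\<psi> 0 s x)"
proof -
  note X = augmented_resolutionD[OF X] and Y = augmented_resolutionD[OF Y]
  from hom obtain h where h: "\<And>i. h i \<in> pers_hom (obj X i) (obj Y (i - 1))"
    and eq: "\<And>i s x. x \<in> fibre (obj X i) s \<Longrightarrow>
      \<phi> i s x - \<psi> i s x = diff Y (i - 1) s (h i s x) + h (i + 1) s (diff X i s x)"
    unfolding chain_homotopic_def by blast
  have "diff X 0 s x = 0"
    using pers_homD(1)[OF X(2) x] X(4)[of 1 s] by simp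
  then have "\<phi> 0 s x - \<psi> 0 s x = diff Y (- 1) s (h 0 s x)"
    using eq[OF x] pers_hom_zero[OF h[of 1] X(1)] by simp
  moreover have "h 0 s x \<in> fibre (obj Y (- 1)) s"
    using pers_homD(1)[OF h x] by simp
  ultimately have "e s (\<phi> 0 s x - \<psi> 0 s x) = 0" using Y(10) by simp
  then show ?thesis
    using pers_hom_diff[OF Y(7,1) pers_homD(1)[OF chain_homD(1)[OF \<phi>] x]
        pers_homD(1)[OF chain_homD(1)[OF \<psi>] x]] by simp
qed

text \<open>Uniqueness half of the comparison theorem. The homotopy is built downwards by lifting,
  at each stage, the part of \<open>\<theta>\<close> not yet accounted for through the differential
  of \<open>Y\<close>.\<close>

lemma chain_homotopicI_augmentation:
  assumes X: "augmented_resolution X M d" and Y: "augmented_resolution Y N e"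
    and free: "\<And>i. free_module (obj X i)"
    and \<phi>: "\<phi> \<in> chain_hom X Y" and \<psi>: "\<psi> \<in> chain_hom X Y"
    and eq: "\<And>s x. x \<in> fibre (obj X 0) s \<Longrightarrow> e s (\<phi> 0 s x) = e s (\<psi> 0 s x)"
  shows "chain_homotopic X Y \<phi> \<psi>"
proof -
  note X = augmented_resolutionD[OF X] and Y = augmented_resolutionD[OF Y]
  define \<theta> where "\<theta> i s x = \<phi> i s x - \<psi> i s x" for i s x
  have \<theta>: "\<theta> i \<in> pers_hom (obj X i) (obj Y i)" for i
    unfolding \<theta>_def using chain_homD(1)[OF \<phi>] chain_homD(1)[OF \<psi>] Y(1) by (rule minus_pers_hom)
  have d\<theta>: "\<theta> (i + 1) s (diff X i s x) = diff Y i s (\<theta> i s x)" if "x \<in> fibre (obj X i) s" for i s x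
    using chain_homD(2)[OF \<phi> that] chain_homD(2)[OF \<psi> that]
      pers_hom_diff[OF Y(2,1) pers_homD(1)[OF chain_homD(1)[OF \<phi>] that]
        pers_homD(1)[OF chain_homD(1)[OF \<psi>] that]]
    by (simp add: \<theta>_def)
  have idx: "- int n - 1 = - 1 - int n" "- int n - 2 = - 2 - int n" for n
    by simp_all
  have dX: "diff X (- 1 - int n) \<in> pers_hom (obj X (- 1 - int n)) (obj X (- int n))" for n
    using X(2)[of "- 1 - int n"] by simp
  have dY: "diff Y (- 1 - int n) \<in> pers_hom (obj Y (- 1 - int n)) (obj Y (- int n))" for n
    using Y(2)[of "- 1 - int n"] by simp
  have dX2: "diff X (- 2 - int n) \<in> pers_hom (obj X (- 2 - int n)) (obj X (- 1 - int n))" for n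
    using X(2)[of "- 2 - int n"] by simp
  have dY2: "diff Y (- 2 - int n) \<in> pers_hom (obj Y (- 2 - int n)) (obj Y (- 1 - int n))" for n
    using Y(2)[of "- 2 - int n"] by simp
  have ddX: "diff X (- 1 - int n) s (diff X (- 2 - int n) s x) = 0"
    if "x \<in> fibre (obj X (- 2 - int n)) s" for n s x
    using X(3)[OF that] by simp
  \<comment> \<open>Here \<open>p\<close> is the homotopy out of degree \<open>- n\<close>, landing
    one degree lower. The last clause says that \<open>\<theta>\<close> minus \<open>p\<close> after
    \<open>diff X\<close> takes cocycles as values in degree \<open>- 1 - n\<close>, hence can be
    lifted. \<open>Q\<close> is the homotopy equation in degree \<open>- 1 - n\<close>.\<close>
  define P where "P n p \<longleftrightarrow> p \<in> pers_hom (obj X (- int n)) (obj Y (- 1 - int n)) \<and>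
      (n = 0 \<longrightarrow> (\<forall>s. \<forall>x\<in>fibre (obj X 0) s. \<theta> 0 s x = diff Y (- 1) s (p s x))) \<and>
      (\<forall>s. \<forall>x\<in>fibre (obj X (- 1 - int n)) s.
         diff Y (- 1 - int n) s (p s (diff X (- 1 - int n) s x)) =
         diff Y (- 1 - int n) s (\<theta> (- 1 - int n) s x))" for n p
  define Q where "Q n p q \<longleftrightarrow> (\<forall>s. \<forall>x\<in>fibre (obj X (- 1 - int n)) s.
      \<theta> (- 1 - int n) s x = diff Y (- 2 - int n) s (q s x) + p s (diff X (- 1 - int n) s x))" for n p q
  have "\<exists>p. P 0 p"
  proof -
    have "\<theta> 0 s x \<in> diff Y (- 1) s ` fibre (obj Y (- 1)) s" if x: "x \<in> fibre (obj X 0) s" for s x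
    proof -
      have "e s (\<theta> 0 s x) = 0"
        using eq[OF x] pers_hom_diff[OF Y(7,1) pers_homD(1)[OF chain_homD(1)[OF \<phi>] x]
            pers_homD(1)[OF chain_homD(1)[OF \<psi>] x]] by (simp add: \<theta>_def)
      then show ?thesis
        using Y(9)[OF pers_homD(1)[OF \<theta> x]] by (simp add: coboundaries_def)
    qed
    moreover have "diff Y (- 1) \<in> pers_hom (obj Y (- 1)) (obj Y 0)" using dY[of 0] by simp
    ultimately obtain p where p: "p \<in> pers_hom (obj X 0) (obj Y (- 1))"
      and dp: "\<And>s x. x \<in> fibre (obj X 0) s \<Longrightarrow> diff Y (- 1) s (p s x) = \<theta> 0 s x"
      using free_module_lift[OF free Y(1) Y(1) _ \<theta>] by blast
    have "diff Y (- 1) s (p s (diff X (- 1) s x)) = diff Y (- 1) s (\<theta> (- 1) s x)"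
      if x: "x \<in> fibre (obj X (- 1)) s" for s x
      using dp[of "diff X (- 1) s x" s] d\<theta>[OF x] pers_homD(1)[OF dX[of 0]] x by simp
    with p dp show ?thesis by (auto simp: P_def)
  qed
  moreover have "\<exists>q. P (Suc n) q \<and> Q n p q" if p: "P n p" for p n
  proof -
    \<comment> \<open>The remainder that the next homotopy component has to hit; by the invariant in
      \<open>P\<close> and exactness of \<open>Y\<close> its values are coboundaries.\<close>
    define r where "r s x = \<theta> (- 1 - int n) s x - p s (diff X (- 1 - int n) s x)" for s x
    have ph: "p \<in> pers_hom (obj X (- int n)) (obj Y (- 1 - int n))" using p by (simp add: P_def)
    have pd: "(\<lambda>s x. p s (diff X (- 1 - int n) s x)) \<in> pers_hom (obj X (- 1 - int n)) (obj Y (- 1 - int n))"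
      using pers_hom_pmor_comp[OF dX ph] by (simp add: pmor_comp_def)
    have r: "r \<in> pers_hom (obj X (- 1 - int n)) (obj Y (- 1 - int n))"
      unfolding r_def using \<theta> pd Y(1) by (rule minus_pers_hom)
    have "r s x \<in> diff Y (- 2 - int n) s ` fibre (obj Y (- 2 - int n)) s"
      if x: "x \<in> fibre (obj X (- 1 - int n)) s" for s x
    proof -
      have "diff Y (- 1 - int n) s (r s x) = 0"
        using p x pers_hom_diff[OF dY Y(1) pers_homD(1)[OF \<theta> x] pers_homD(1)[OF pd x]]
        by (simp add: P_def r_def)
      then have "r s x \<in> coboundaries Y (- 1 - int n) s"
        using Y(5)[OF _ pers_homD(1)[OF r x]] by simp
      then show ?thesis by (simp add: coboundaries_def)
    qed
    then obtain q where q: "q \<in> pers_hom (obj X (- 1 - int n)) (obj Y (- 2 - int n))"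
      and dq: "\<And>s x. x \<in> fibre (obj X (- 1 - int n)) s \<Longrightarrow> diff Y (- 2 - int n) s (q s x) = r s x"
      using free_module_lift[OF free Y(1) Y(1) dY2 r] by blast
    \<comment> \<open>The invariant for the successor: on a coboundary of \<open>X\<close> the
      \<open>p\<close> term of \<open>r\<close> vanishes, and \<open>\<theta>\<close> commutes with
      the differentials.\<close>
    have "diff Y (- 2 - int n) s (q s (diff X (- 2 - int n) s x)) =
        diff Y (- 2 - int n) s (\<theta> (- 2 - int n) s x)"
      if x: "x \<in> fibre (obj X (- 2 - int n)) s" for s x
      using dq[OF pers_homD(1)[OF dX2 x]] ddX[OF x] d\<theta>[OF x] pers_hom_zero[OF ph X(1)]
      by (simp add: r_def)
    moreover have "\<theta> (- 1 - int n) s x = diff Y (- 2 - int n) s (q s x) + p s (diff X (- 1 - int n) s x)"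
      if "x \<in> fibre (obj X (- 1 - int n)) s" for s x
      using dq[OF that] by (simp add: r_def)
    ultimately show ?thesis
      using q by (intro exI[of _ q]) (simp add: P_def Q_def idx)
  qed
  ultimately obtain p where P: "\<And>n. P n (p n)" and Q: "\<And>n. Q n (p n) (p (Suc n))"
    using dependent_nat_choice[of P Q] by blast
  define h where "h i = (if i \<le> 0 then p (nat (- i)) else (\<lambda>s x. 0))" for i :: int
  have h: "h i \<in> pers_hom (obj X i) (obj Y (i - 1))" for i
    using P[of "nat (- i)"] zero_pers_hom[OF Y(1)] by (cases "i \<le> 0") (simp_all add: h_def P_def)
  have "\<theta> i s x = diff Y (i - 1) s (h i s x) + h (i + 1) s (diff X i s x)"
    if x: "x \<in> fibre (obj X i) s" for i s x
  proof -
    consider "i < 0" | "i = 0" | "i > 0" by linarith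
    then show ?thesis
    proof cases
      case 1
      define n where "n = nat (- i - 1)"
      have i: "i = - 1 - int n" using 1 by (simp add: n_def)
      have "nat (- i) = Suc n" "nat (- (i + 1)) = n" using i by auto
      then show ?thesis
        using Q[of n] x i by (auto simp: h_def Q_def)
    next
      case 2
      \<comment> \<open>\<open>Q\<close> only starts in degree -1, so the equation in degree 0 comes
        from the clause for \<open>n = 0\<close> in \<open>P\<close>.\<close>
      have "diff X 0 s x = 0"
        using pers_homD(1)[OF X(2) x] X(4)[of 1 s] 2 by simp
      then show ?thesis
        using P[of 0] x 2 pers_hom_zero[OF h[of 1] X(1)] by (simp add: P_def h_def)
    next
      case 3
      then have "x = 0" using x X(4) by simp
      then show ?thesis
        using pers_hom_zero[OF \<theta> X(1)] pers_hom_zero[OF h X(1)] pers_hom_zero[OF X(2,1)]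
          pers_hom_zero[OF Y(2,1)] by simp
    qed
  qed
  then show ?thesis
    unfolding chain_homotopic_def using h by (auto simp: \<theta>_def)
qed

section \<open>Morphisms of the homotopy category as sets of lifts\<close>

text \<open>Two chain maps are homotopic exactly when they agree after \<open>e\<close> in degree 0,
  and for a lift of \<open>f\<close> this common value is \<open>f\<close> after
  \<open>d\<close>.\<close>

lemma K_class_lifts:
  assumes X: "augmented_resolution X M d" and Y: "augmented_resolution Y N e"
    and free: "\<And>i. free_module (obj X i)" and \<phi>: "\<phi> \<in> lifts X Y d e f"
  shows "K_class X Y \<phi> = lifts X Y d e f"
proof -
  have \<phi>': "\<phi> \<in> chain_hom X Y"
    and e\<phi>: "\<And>s x. x \<in> fibre (obj X 0) s \<Longrightarrow> e s (\<phi> 0 s x) = f s (d s x)"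
    using \<phi> by (auto simp: lifts_def)
  have "chain_homotopic X Y \<phi> \<psi> \<longleftrightarrow> \<psi> \<in> lifts X Y d e f" if \<psi>: "\<psi> \<in> chain_hom X Y" for \<psi>
  proof
    assume "chain_homotopic X Y \<phi> \<psi>"
    then show "\<psi> \<in> lifts X Y d e f"
      using \<psi> e\<phi> chain_homotopic_augmentation[OF X Y \<phi>' \<psi>] by (simp add: lifts_def)
  next
    assume "\<psi> \<in> lifts X Y d e f"
    then show "chain_homotopic X Y \<phi> \<psi>"
      using e\<phi> by (intro chain_homotopicI_augmentation[OF X Y free \<phi>' \<psi>]) (simp add: lifts_def)
  qed
  then show ?thesis
    using \<phi>' by (auto simp: K_class_def homotopy_rel_def lifts_def)
qed

text \<open>Every chain map lifts some morphism and every morphism has a lift. This lets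
  quantification over homotopy classes be replaced by quantification over morphisms of
  modules.\<close>

lemma K_hom_eq_lifts:
  assumes X: "augmented_resolution X M d" and Y: "augmented_resolution Y N e"
    and free: "\<And>i. free_module (obj X i)"
  shows "K_hom X Y = lifts X Y d e ` pers_hom M N"
proof (intro equalityI subsetI)
  fix F assume "F \<in> K_hom X Y"
  then obtain \<phi> where \<phi>: "\<phi> \<in> chain_hom X Y" and F: "F = K_class X Y \<phi>"
    unfolding K_hom_def K_class_def quotient_def by blast
  obtain f where "f \<in> pers_hom M N" "\<phi> \<in> lifts X Y d e f"
    using chain_hom_lifts[OF X Y \<phi>] .
  then show "F \<in> lifts X Y d e ` pers_hom M N"
    using K_class_lifts[OF X Y free] F by blast
next
  fix F assume "F \<in> lifts X Y d e ` pers_hom M N"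
  then obtain f where f: "f \<in> pers_hom M N" and F: "F = lifts X Y d e f" by blast
  obtain \<phi> where \<phi>: "\<phi> \<in> lifts X Y d e f" using lifts_nonempty[OF X Y free f] by blast
  then have "F = K_class X Y \<phi>" using K_class_lifts[OF X Y free] F by blast
  then show "F \<in> K_hom X Y"
    using \<phi> unfolding K_hom_def K_class_def lifts_def quotient_def by blast
qed

text \<open>Faithfulness: a common lift gives \<open>f\<close> after \<open>d\<close> equal to
  \<open>f'\<close> after \<open>d\<close>, and \<open>d\<close> is onto. The existence of a lift of
  \<open>f\<close> rules out that the two sets agree by being empty.\<close>

lemma lifts_eq_iff:
  assumes X: "augmented_resolution X M d" and Y: "augmented_resolution Y N e"
    and free: "\<And>i. free_module (obj X i)" and f: "f \<in> pers_hom M N"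
  shows "lifts X Y d e f = lifts X Y d e f' \<longleftrightarrow> pmor_eq M f f'"
proof
  assume eq: "lifts X Y d e f = lifts X Y d e f'"
  obtain \<phi> where "\<phi> \<in> lifts X Y d e f" using lifts_nonempty[OF X Y free f] by blast
  moreover from this eq have "\<phi> \<in> lifts X Y d e f'" by simp
  ultimately have "f s (d s x) = f' s (d s x)" if "x \<in> fibre (obj X 0) s" for s x
    using that by (simp add: lifts_def)
  then show "pmor_eq M f f'"
    unfolding pmor_eq_def augmented_resolutionD(8)[OF X, symmetric] by blast
next
  assume "pmor_eq M f f'"
  then show "lifts X Y d e f = lifts X Y d e f'"
    using pers_homD(1)[OF augmented_resolutionD(7)[OF X]] by (auto simp: lifts_def pmor_eq_def)
qed

lemma chain_comp_lifts:
  assumes "\<phi> \<in> lifts X Y d e f" "\<psi> \<in> lifts Y Z e c g"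
  shows "chain_comp \<psi> \<phi> \<in> lifts X Z d c (pmor_comp g f)"
proof -
  have \<phi>: "\<phi> \<in> chain_hom X Y" and \<psi>: "\<psi> \<in> chain_hom Y Z"
    using assms by (auto simp: lifts_def)
  have "chain_comp \<psi> \<phi> \<in> chain_hom X Z"
    using pers_hom_pmor_comp[OF chain_homD(1)[OF \<phi>] chain_homD(1)[OF \<psi>]]
      chain_homD(2)[OF \<phi>] chain_homD(2)[OF \<psi>] pers_homD(1)[OF chain_homD(1)[OF \<phi>]]
    by (simp add: chain_hom_def chain_comp_def pmor_comp_def)
  then show ?thesis
    using assms pers_homD(1)[OF chain_homD(1)[OF \<phi>]]
    by (simp add: lifts_def chain_comp_def pmor_comp_def)
qed

text \<open>Composites of lifts lift the composite, so the union in \<open>K_comp\<close> is over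
  copies of one set; it is nonempty because both morphisms have lifts.\<close>

lemma K_comp_lifts:
  assumes X: "augmented_resolution X L d" and Y: "augmented_resolution Y M e"
    and Z: "augmented_resolution Z N c"
    and freeX: "\<And>i. free_module (obj X i)" and freeY: "\<And>i. free_module (obj Y i)"
    and f: "f \<in> pers_hom L M" and g: "g \<in> pers_hom M N"
  shows "K_comp X Z (lifts Y Z e c g) (lifts X Y d e f) = lifts X Z d c (pmor_comp g f)"
proof -
  have "K_class X Z (chain_comp \<psi> \<phi>) = lifts X Z d c (pmor_comp g f)"
    if "\<psi> \<in> lifts Y Z e c g" "\<phi> \<in> lifts X Y d e f" for \<phi> \<psi>
    using K_class_lifts[OF X Z freeX chain_comp_lifts[OF that(2,1)]] .
  then show ?thesis
    using lifts_nonempty[OF X Y freeX f] lifts_nonempty[OF Y Z freeY g]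
    unfolding K_comp_def by auto
qed

section \<open>Shifts and smoothings\<close>

lemma pshift_simps [simp]:
  "fibre (pshift \<epsilon> M) s = fibre M (s + vec \<epsilon>)"
  "scl (pshift \<epsilon> M) = scl M"
  "tr (pshift \<epsilon> M) s t = tr M (s + vec \<epsilon>) (t + vec \<epsilon>)"
  by (simp_all add: pshift_def)

lemma pshift_pshift: "pshift \<epsilon> (pshift \<delta> M) = pshift (\<epsilon> + \<delta>) M"
  by (simp add: pshift_def fun_eq_iff add.assoc vec_add)

lemma cshift_simps [simp]:
  "obj (cshift \<epsilon> X) i = pshift \<epsilon> (obj X i)"
  "diff (cshift \<epsilon> X) i = pmor_shift \<epsilon> (diff X i)"
  by (simp_all add: cshift_def)

lemma persistence_module_pshift: "persistence_module M \<Longrightarrow> persistence_module (pshift \<epsilon> M)"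
  unfolding persistence_module_def by simp

lemma pers_hom_pshift: "f \<in> pers_hom M N \<Longrightarrow> pmor_shift \<epsilon> f \<in> pers_hom (pshift \<epsilon> M) (pshift \<epsilon> N)"
  unfolding pers_hom_def pmor_shift_def by simp

text \<open>\<open>a \<le> s + vec \<epsilon>\<close> iff \<open>a - vec \<epsilon> \<le> s\<close>:
  each generator is born earlier by \<open>\<epsilon>\<close> in every coordinate. This is why
  shifts preserve freeness.\<close>

lemma pshift_free_sum: "pshift \<epsilon> (free_sum as) = free_sum (map (\<lambda>a. a - vec \<epsilon>) as)"
  by (auto simp: pshift_def free_sum_def elementary_free_def fun_eq_iff diff_le_eq)

lemma free_module_pshift:
  assumes "free_module M"
  shows "free_module (pshift \<epsilon> M)"
proof -
  obtain as f g where f: "f \<in> pers_hom M (free_sum as)" and g: "g \<in> pers_hom (free_sum as) M"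
    and gf: "pmor_eq M (pmor_comp g f) pmor_id"
    and fg: "pmor_eq (free_sum as) (pmor_comp f g) pmor_id"
    using assms unfolding free_module_def pers_iso_def by blast
  have "pers_iso (pshift \<epsilon> M) (pshift \<epsilon> (free_sum as))"
    unfolding pers_iso_def
    using gf fg
    by (intro bexI[OF _ pers_hom_pshift[OF f]] bexI[OF _ pers_hom_pshift[OF g]])
       (simp add: pmor_eq_def pmor_comp_def pmor_shift_def pmor_id_def)
  then show ?thesis
    using assms persistence_module_pshift unfolding free_module_def pshift_free_sum by blast
qed

text \<open>Exactness and the augmentation conditions are pointwise in \<open>s\<close>, and
  shifting merely translates \<open>s\<close>.\<close>

lemma augmented_resolution_cshift:
  assumes "augmented_resolution X M e"
  shows "augmented_resolution (cshift \<epsilon> X) (pshift \<epsilon> M) (pmor_shift \<epsilon> e)"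
  using assms
  unfolding augmented_resolution_def cochain_complex_def cocycles_def coboundaries_def
  by (simp add: persistence_module_pshift pers_hom_pshift) (simp add: pmor_shift_def)

lemma cmor_shift_lifts:
  assumes "\<phi> \<in> lifts X Y d e f"
  shows "cmor_shift \<epsilon> \<phi> \<in>
    lifts (cshift \<epsilon> X) (cshift \<epsilon> Y) (pmor_shift \<epsilon> d) (pmor_shift \<epsilon> e) (pmor_shift \<epsilon> f)"
  using assms unfolding lifts_def chain_hom_def cmor_shift_def
  by (simp add: pers_hom_pshift) (simp add: pmor_shift_def)

text \<open>Shifts of lifts are lifts of the shift, and the shifted source is still free, so all
  members of the union in \<open>K_shift\<close> are the same class.\<close>

lemma K_shift_lifts:
  assumes X: "augmented_resolution X M d" and Y: "augmented_resolution Y N e"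
    and free: "\<And>i. free_module (obj X i)" and f: "f \<in> pers_hom M N"
  shows "K_shift X Y \<epsilon> (lifts X Y d e f) =
    lifts (cshift \<epsilon> X) (cshift \<epsilon> Y) (pmor_shift \<epsilon> d) (pmor_shift \<epsilon> e) (pmor_shift \<epsilon> f)"
proof -
  have "K_class (cshift \<epsilon> X) (cshift \<epsilon> Y) (cmor_shift \<epsilon> \<phi>) =
    lifts (cshift \<epsilon> X) (cshift \<epsilon> Y) (pmor_shift \<epsilon> d) (pmor_shift \<epsilon> e) (pmor_shift \<epsilon> f)"
    if "\<phi> \<in> lifts X Y d e f" for \<phi>
    using K_class_lifts[OF augmented_resolution_cshift[OF X] augmented_resolution_cshift[OF Y] _
        cmor_shift_lifts[OF that]] free by (simp add: free_module_pshift)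
  then show ?thesis
    using lifts_nonempty[OF X Y free f] unfolding K_shift_def by auto
qed

text \<open>By functoriality, both ways around the naturality square are the transition map from
  \<open>s\<close> to \<open>t + vec \<epsilon>\<close>.\<close>

lemma smoothing_pers_hom:
  fixes M :: "('k::field, 'n::finite, 'v::ab_group_add) pers"
  assumes M: "persistence_module M" and "0 \<le> \<epsilon>"
  shows "smoothing \<epsilon> M \<in> pers_hom M (pshift \<epsilon> M)"
proof -
  have le: "s \<le> s + vec \<epsilon>" for s :: "real^'n"
    using \<open>0 \<le> \<epsilon>\<close> by (simp add: less_eq_vec_def)
  show ?thesis
  proof (rule pers_homI)
    fix s t :: "real^'n" and x assume "s \<le> t" and x: "x \<in> fibre M s"
    moreover have "s + vec \<epsilon> \<le> t + vec \<epsilon>" using \<open>s \<le> t\<close> by simp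
    ultimately show "smoothing \<epsilon> M t (tr M s t x) = tr (pshift \<epsilon> M) s t (smoothing \<epsilon> M s x)"
      using le by (simp add: smoothing_def persistence_moduleD(5)[OF M])
  qed (simp_all add: smoothing_def tr_fibre[OF M le] tr_add[OF M le] tr_scale[OF M le])
qed

text \<open>Smoothing consists of transition maps, with which every morphism commutes; for
  \<open>diff X\<close> this yields the chain map equation, for \<open>e\<close> the lifting
  equation.\<close>

lemma csmoothing_lifts:
  fixes X :: "('k::field, 'n::finite, 'v::ab_group_add) cochain"
  assumes X: "augmented_resolution X M e" and \<epsilon>: "0 \<le> \<epsilon>"
  shows "csmoothing \<epsilon> X \<in> lifts X (cshift \<epsilon> X) e (pmor_shift \<epsilon> e) (smoothing \<epsilon> M)"
proof -
  note X = augmented_resolutionD[OF X]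
  have le: "s \<le> s + vec \<epsilon>" for s :: "real^'n"
    using \<epsilon> by (simp add: less_eq_vec_def)
  show ?thesis
    using smoothing_pers_hom[OF X(1) \<epsilon>] pers_homD(4)[OF X(2) le] pers_homD(4)[OF X(7) le]
    unfolding lifts_def chain_hom_def csmoothing_def
    by simp (simp add: pmor_shift_def smoothing_def)
qed

section \<open>Interleavings\<close>

text \<open>Both sides of the first equation are sets of lifts from \<open>X\<close> to its shift by
  \<open>2 * \<epsilon>\<close>, of the composite and of the smoothing respectively, so faithfulness
  compares the underlying morphisms.\<close>

lemma K_interleaving_equation_iff:
  assumes X: "augmented_resolution X M d" and Y: "augmented_resolution Y N e"
    and freeX: "\<And>i. free_module (obj X i)" and freeY: "\<And>i. free_module (obj Y i)"
    and \<epsilon>: "0 \<le> \<epsilon>" and f: "f \<in> pers_hom M (pshift \<epsilon> N)" and g: "g \<in> pers_hom N (pshift \<epsilon> M)"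
  shows "K_comp X (cshift (2 * \<epsilon>) X)
      (K_shift Y (cshift \<epsilon> X) \<epsilon> (lifts Y (cshift \<epsilon> X) e (pmor_shift \<epsilon> d) g))
      (lifts X (cshift \<epsilon> Y) d (pmor_shift \<epsilon> e) f) =
    K_class X (cshift (2 * \<epsilon>) X) (csmoothing (2 * \<epsilon>) X) \<longleftrightarrow>
    pmor_eq M (pmor_comp (pmor_shift \<epsilon> g) f) (smoothing (2 * \<epsilon>) M)"
proof -
  let ?X = "cshift (2 * \<epsilon>) X" and ?d = "pmor_shift (2 * \<epsilon>) d"
  note X1 = augmented_resolution_cshift[OF X] and Y1 = augmented_resolution_cshift[OF Y]
  \<comment> \<open>Shifting twice by \<open>\<epsilon>\<close> equals shifting by
    \<open>2 * \<epsilon>\<close> on the nose, so the shifted class of \<open>g\<close> can be read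
    as a class of maps into \<open>?X\<close>.\<close>
  have twice: "cshift \<epsilon> (cshift \<epsilon> X) = ?X" "pmor_shift \<epsilon> (pmor_shift \<epsilon> d) = ?d"
    "pshift \<epsilon> (pshift \<epsilon> M) = pshift (2 * \<epsilon>) M"
    by (simp_all add: cshift_cshift pshift_pshift pmor_shift_def add.assoc flip: vec_add)
  have g': "pmor_shift \<epsilon> g \<in> pers_hom (pshift \<epsilon> N) (pshift (2 * \<epsilon>) M)"
    using pers_hom_pshift[OF g, of \<epsilon>] by (simp only: twice)
  have freeY1: "\<And>i. free_module (obj (cshift \<epsilon> Y) i)"
    using freeY by (simp add: free_module_pshift)
  have "K_shift Y (cshift \<epsilon> X) \<epsilon> (lifts Y (cshift \<epsilon> X) e (pmor_shift \<epsilon> d) g) =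
      lifts (cshift \<epsilon> Y) ?X (pmor_shift \<epsilon> e) ?d (pmor_shift \<epsilon> g)"
    using K_shift_lifts[OF Y X1 freeY g, of \<epsilon>] by (simp only: twice)
  then have "K_comp X ?X
      (K_shift Y (cshift \<epsilon> X) \<epsilon> (lifts Y (cshift \<epsilon> X) e (pmor_shift \<epsilon> d) g))
      (lifts X (cshift \<epsilon> Y) d (pmor_shift \<epsilon> e) f) =
      lifts X ?X d ?d (pmor_comp (pmor_shift \<epsilon> g) f)"
    using K_comp_lifts[OF X Y1 X1 freeX freeY1 f g'] by simp
  moreover have "K_class X ?X (csmoothing (2 * \<epsilon>) X) = lifts X ?X d ?d (smoothing (2 * \<epsilon>) M)"
    using K_class_lifts[OF X X1 freeX csmoothing_lifts[OF X]] \<epsilon> by simp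
  ultimately show ?thesis
    using lifts_eq_iff[OF X X1 freeX pers_hom_pmor_comp[OF f g']] by simp
qed

lemma K_interleaved_iff:
  assumes X: "augmented_resolution X M d" and Y: "augmented_resolution Y N e"
    and freeX: "\<And>i. free_module (obj X i)" and freeY: "\<And>i. free_module (obj Y i)"
    and \<epsilon>: "0 \<le> \<epsilon>"
  shows "K_interleaved \<epsilon> X Y \<longleftrightarrow> interleaved \<epsilon> M N"
  \<comment> \<open>The classes \<open>F\<close> and \<open>G\<close> become the lift sets of
    morphisms \<open>f\<close> and \<open>g\<close>. The two interleaving equations then match one
    by one, the second with the roles of \<open>X\<close> and \<open>Y\<close> exchanged.\<close>
  unfolding K_interleaved_def interleaved_def
    K_hom_eq_lifts[OF X augmented_resolution_cshift[OF Y] freeX]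
    K_hom_eq_lifts[OF Y augmented_resolution_cshift[OF X] freeY]
  using K_interleaving_equation_iff[OF X Y freeX freeY \<epsilon>]
    K_interleaving_equation_iff[OF Y X freeY freeX \<epsilon>]
  by auto

theorem corollary5p23:
  fixes M :: "('k::field, 'n::finite, 'v::ab_group_add) pers"
    and N :: "('k, 'n, 'w::ab_group_add) pers"
    and \<pi>M :: "('k, 'n, 'a::ab_group_add) cochain"
    and \<pi>N :: "('k, 'n, 'b::ab_group_add) cochain"
  assumes "finitely_presented M" and "finitely_presented N"
    and "minimal_free_resolution \<pi>M M" and "minimal_free_resolution \<pi>N N"
  shows "d_I_K \<pi>M \<pi>N = d_I M N"
proof -
  have res: "free_resolution \<pi>M M" "free_resolution \<pi>N N"
    using assms(3,4) by (simp_all add: minimal_free_resolution_def)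
  obtain d e where "augmented_resolution \<pi>M M d" "augmented_resolution \<pi>N N e"
    using free_resolution_augmented[OF res(1)] free_resolution_augmented[OF res(2)] assms(1,2)
    unfolding finitely_presented_def by metis
  \<comment> \<open>Hence both distances are infima of the same set of parameters.\<close>
  then have "K_interleaved \<epsilon> \<pi>M \<pi>N \<longleftrightarrow> interleaved \<epsilon> M N" if "0 \<le> \<epsilon>" for \<epsilon>
    using res that by (intro K_interleaved_iff) (auto simp: free_resolution_def)
  then show ?thesis
    unfolding d_I_K_def d_I_def by metis
qed

end
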